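(* Assume $n_1=\cdots=n_m=n$ with $m\ge2$. There is a universal constant $c>0$ such that in the transfer-relevant regime $n_0\ll mn$, i.e. along any sequence of parameters $(m,n,n_0,d,\tau)$ with $m\ge2$, $d\tau^2/n_0\le1$ and $n_0/(mn)\to0$, one has, eventually along the sequence, $$\mathfrak C^\star([0,1]^m)\;\ge\;c\left\{\left(\frac{mn}{n_0}\wedge\sqrt{\frac md}\right)\vee\frac{mn}{d\,n_0}\vee1\right\}.$$ In particular, if $n_0=n$, then $\mathfrak C^\star([0,1]^m)\ge c\left(\frac md\vee1\right)$ eventually along the sequence.
   Context: There are $m+1$ domains ($k=0$ target, $k=1,\dots,m$ sources), with parameters $\theta_0^\star,\dots,\theta_m^\star\in\mathbb R^d$, sample sizes $\boldsymbol n=(n_0,\dots,n_m)$ and local estimators $\widetilde\theta_0,\dots,\widetilde\theta_m$. A constant $C_\tau>0$ is fixed throughout and suppressed from notation. For $\boldsymbol h\in[0,1]^m$, $\mathcal P(\boldsymbol h,\boldsymbol n,\tau)$ is the set of joint distributions of $(\widetilde\theta_0,\dots,\widetilde\theta_m)$ such that the $\widetilde\theta_k$ are independent and there exist $\theta_0^\star,\dots,\theta_m^\star\in\mathbb R^d$ with $\|\theta_k^\star-\theta_0^\star\|_2\le h_k$ for $k=1,\dots,m$ and $\max_{\|a\|_2=1}P(a^\top(\widetilde\theta_k-\theta_k^\star)>t)\le C_\tau\exp(-n_kt^2/(2\tau^2))$ for all $t>0$ and $k=0,\dots,m$. Oracle rate: with $h_0:=0$, $\mathfrak R(\boldsymbol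 h,\boldsymbol n,\tau):=\min_{\{0\}\subset S\subset\{0,\dots,m\}}\{d\tau^2/\sum_{k\in S}n_k+\max_{k\in S}h_k^2\}$. For $\mathcal H\subset[0,1]^m$ and an estimator $\widehat\theta_0$ depending on $\{\widetilde\theta_k\}_{k=0}^m$, $\boldsymbol n$, $\tau$ but not on $\boldsymbol h$, the adaptation cost is $\mathfrak C(\widehat\theta_0,\mathcal H):=\sup_{\boldsymbol h\in\mathcal H}\dfrac{\sup_{P\in\mathcal P(\boldsymbol h,\boldsymbol n,\tau)}\mathbb E_P[\|\widehat\theta_0-\theta_0^\star\|_2^2]}{\mathfrak R(\boldsymbol h,\boldsymbol n,\tau)}$, and the intrinsic cost of adaptation is $\mathfrak C^\star(\mathcal H):=\inf_{\widehat\theta_0}\mathfrak C(\widehat\theta_0,\mathcal H)$ over all such estimators. $a\wedge b=\min(a,b)$, $a\vee b=\max(a,b)$.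
   Formalization: The constant C_τ is required to be at least 1/2 rather than merely positive: for C_τ<1/2 every local estimator equals its parameter with positive probability, no Gaussian law is in the class, and the stated lower bound fails. *)

theory Defs
  imports "HOL-Probability.Probability"
begin

text \<open>
  The dimension d varies along sequences of parameters, so R^d is represented by the
  functions on the index set \<open>{..<d}\<close> with the product Borel sigma-algebra, and the
  Euclidean norm by \<open>L2_set _ {..<d}\<close>.
\<close>

definition vec_space :: "nat \<Rightarrow> (nat \<Rightarrow> real) measure" where
  "vec_space d = (\<Pi>\<^sub>M i\<in>{..<d}. borel)"

text \<open>An outcome \<open>\<omega>\<close> collects the local estimators: \<open>\<omega> k\<close> is the one of domain k.\<close>

definition data_space :: "nat \<Rightarrow> nat \<Rightarrow> (nat \<Rightarrow> nat \<Rightarrow> real) measure" where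
  "data_space d m = (\<Pi>\<^sub>M k\<in>{0..m}. vec_space d)"

text \<open>
  \<open>admissible C d m h n \<tau> \<theta> P\<close>: the joint law P of the local estimators belongs to the class with
  similarity levels h, sample sizes n and noise level \<open>\<tau>\<close>, and this is witnessed by the true
  parameters \<open>\<theta> 0, \<dots>, \<theta> m\<close>. The witness is kept explicit, because the loss below refers to
  \<open>\<theta> 0\<close> while P need not determine it: for C > 1/2 the same P may be admissible for several
  \<open>\<theta>\<close>. For C < 1/2, letting t tend to 0 in the tail bound shows that every local estimator equals
  its parameter with probability at least 1 - 2 C, so that no Gaussian law is admissible.
  The maximum over unit vectors in the tail bound is expressed by quantifying over them.
\<close>

definition admissible ::
  "real \<Rightarrow> nat \<Rightarrow> nat \<Rightarrow> (nat \<Rightarrow> real) \<Rightarrow> (nat \<Rightarrow> nat) \<Rightarrow> real \<Rightarrow>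
   (nat \<Rightarrow> nat \<Rightarrow> real) \<Rightarrow> (nat \<Rightarrow> nat \<Rightarrow> real) measure \<Rightarrow> bool" where
  "admissible C d m h n \<tau> \<theta> P \<longleftrightarrow>
     prob_space P \<and> sets P = sets (data_space d m) \<and>
     prob_space.indep_vars P (\<lambda>_. vec_space d) (\<lambda>k \<omega>. \<omega> k) {0..m} \<and>
     (\<forall>k\<in>{0..m}. \<theta> k \<in> space (vec_space d)) \<and>
     (\<forall>k\<in>{1..m}. L2_set (\<lambda>i. \<theta> k i - \<theta> 0 i) {..<d} \<le> h k) \<and>
     (\<forall>k\<in>{0..m}. \<forall>t>0. \<forall>a\<in>space (vec_space d). L2_set a {..<d} = 1 \<longrightarrow>
        measure P {\<omega> \<in> space P. (\<Sum>i<d. a i * (\<omega> k i - \<theta> k i)) > t}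
          \<le> C * exp (- (real (n k) * t\<^sup>2 / (2 * \<tau>\<^sup>2))))"

definition oracle_rate :: "nat \<Rightarrow> nat \<Rightarrow> (nat \<Rightarrow> real) \<Rightarrow> (nat \<Rightarrow> nat) \<Rightarrow> real \<Rightarrow> real" where
  "oracle_rate d m h n \<tau> =
     Min ((\<lambda>S. real d * \<tau>\<^sup>2 / (\<Sum>k\<in>S. real (n k)) + Max ((\<lambda>k. ((h(0 := 0)) k)\<^sup>2) ` S))
            ` {S. {0} \<subseteq> S \<and> S \<subseteq> {0..m}})"

text \<open>Risks may be infinite, so they and the costs take values in \<open>ennreal\<close>.\<close>

definition worst_risk ::
  "real \<Rightarrow> nat \<Rightarrow> nat \<Rightarrow> (nat \<Rightarrow> real) \<Rightarrow> (nat \<Rightarrow> nat) \<Rightarrow> real \<Rightarrow>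
   ((nat \<Rightarrow> nat \<Rightarrow> real) \<Rightarrow> nat \<Rightarrow> real) \<Rightarrow> ennreal" where
  "worst_risk C d m h n \<tau> est =
     (SUP (\<theta>, P) \<in> {(\<theta>, P). admissible C d m h n \<tau> \<theta> P}.
        \<integral>\<^sup>+ \<omega>. ennreal ((L2_set (\<lambda>i. est \<omega> i - \<theta> 0 i) {..<d})\<^sup>2) \<partial>P)"

definition adaptation_cost ::
  "real \<Rightarrow> nat \<Rightarrow> nat \<Rightarrow> (nat \<Rightarrow> nat) \<Rightarrow> real \<Rightarrow>
   ((nat \<Rightarrow> nat \<Rightarrow> real) \<Rightarrow> nat \<Rightarrow> real) \<Rightarrow> (nat \<Rightarrow> real) set \<Rightarrow> ennreal" where
  "adaptation_cost C d m n \<tau> est H =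
     (SUP h\<in>H. worst_risk C d m h n \<tau> est / ennreal (oracle_rate d m h n \<tau>))"

text \<open>
  The infimum is taken for fixed n and \<open>\<tau>\<close>, so the estimator may depend on them; it may not
  depend on h, over which the supremum is taken inside.
\<close>

definition intrinsic_cost ::
  "real \<Rightarrow> nat \<Rightarrow> nat \<Rightarrow> (nat \<Rightarrow> nat) \<Rightarrow> real \<Rightarrow> (nat \<Rightarrow> real) set \<Rightarrow> ennreal" where
  "intrinsic_cost C d m n \<tau> H =
     (INF est \<in> data_space d m \<rightarrow>\<^sub>M vec_space d. adaptation_cost C d m n \<tau> est H)"

definition unit_cube :: "nat \<Rightarrow> (nat \<Rightarrow> real) set" where
  "unit_cube m = ({1..m} \<rightarrow>\<^sub>E {0..1})"

end

theory Submission
  imports Defs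
begin

text \<open>
  The lower bound comes from Gaussian local estimators and from sources that hide which of them agree
  with the target. Let the target parameter be \<open>\<delta> v\<close> with a vertex \<open>v\<close> of the hypercube in \<open>a \<le> d\<close>
  coordinates, and let the sources form \<open>p\<close> pairs with parameters \<open>\<delta> v\<close> and \<open>- \<delta> v\<close> in an order given by
  hidden random signs. An oracle that knows the similarity levels pools the \<open>p\<close> aligned sources with
  the target, and its rate is at most \<open>d \<tau>\<^sup>2 / (n0 + p n)\<close>. An estimator that does not know them faces
  the mixture over the signs, under which each pair has the likelihood ratio
  \<open>exp (- a \<kappa>) cosh \<langle>v, y\<rangle>\<close> with \<open>\<kappa> = \<delta>\<^sup>2 n / \<tau>\<^sup>2\<close>, where \<open>y\<close> is the rescaled difference of the two
  estimators. The linear signal has cancelled, and two vertices that differ in one coordinate are at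
  chi-square distance at most of order \<open>a \<kappa>\<^sup>2\<close> per pair, and at distance 0 if \<open>a = 1\<close>
  (lemma \<open>pair_majorant_integral\<close>). As long as \<open>n0 \<delta>\<^sup>2 / \<tau>\<^sup>2\<close>, \<open>a \<kappa>\<close> and \<open>p a \<kappa>\<^sup>2\<close> are small, neighbouring
  vertices cannot be told apart, and Assouad's argument (lemma \<open>hypercube_bound\<close>) yields a risk of at
  least \<open>a \<delta>\<^sup>2 / 2\<close> for some configuration. Dividing by the oracle rate gives lemma
  \<open>intrinsic_cost_ge\<close>.

  Three choices of \<open>a\<close>, \<open>p\<close> and \<open>\<delta>\<close> give the three terms. One active coordinate with \<open>p = m div 2\<close> and
  \<open>\<delta>\<^sup>2\<close> of order \<open>\<tau>\<^sup>2 / n0\<close> gives \<open>m n / (d n0)\<close>. All coordinates with \<open>p = m div 2\<close> and \<open>\<delta>\<^sup>2\<close> of the order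
  of the minimum of \<open>\<tau>\<^sup>2 / n0\<close> and \<open>\<tau>\<^sup>2 / (n sqrt (m d))\<close> give the minimum of \<open>m n / n0\<close> and
  \<open>sqrt (m / d)\<close>. All coordinates with \<open>p = 0\<close> give the constant. The numerical
  constants of the three bounds are at least 1/96.

  A larger tail constant \<open>C\<close> only enlarges the class of laws, and Gaussian laws belong to it for
  \<open>C = 1/2\<close>, by the bound \<open>P (N(0, s\<^sup>2) > t) \<le> exp (- t\<^sup>2 / (2 s\<^sup>2)) / 2\<close> of lemma \<open>gauss_tail\<close>.
\<close>

section \<open>Finite product measures\<close>

text \<open>
  Both sides agree on boxes, where the density integrates to a product by Fubini's theorem. This
  yields likelihood ratios of product measures from those of their factors.
\<close>

lemma PiM_density:
  fixes M :: "'i \<Rightarrow> 'a measure" and f :: "'i \<Rightarrow> 'a \<Rightarrow> ennreal"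
  assumes I: "finite I"
    and M: "\<And>i. sigma_finite_measure (M i)"
    and D: "\<And>i. sigma_finite_measure (density (M i) (f i))"
    and f[measurable]: "\<And>i. f i \<in> borel_measurable (M i)"
  shows "PiM I (\<lambda>i. density (M i) (f i)) = density (PiM I M) (\<lambda>x. \<Prod>i\<in>I. f i (x i))"
proof -
  interpret M: product_sigma_finite M by (rule product_sigma_finite.intro) (rule M)
  interpret D: product_sigma_finite "\<lambda>i. density (M i) (f i)"
    by (rule product_sigma_finite.intro) (rule D)
  show ?thesis
  proof (rule D.PiM_eqI[symmetric])
    show "sets (density (PiM I M) (\<lambda>x. \<Prod>i\<in>I. f i (x i))) = sets (PiM I (\<lambda>i. density (M i) (f i)))"
      by (simp cong: sets_PiM_cong)
  next
    fix A assume "\<And>i. i \<in> I \<Longrightarrow> A i \<in> sets (density (M i) (f i))"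
    then have A: "\<And>i. i \<in> I \<Longrightarrow> A i \<in> sets (M i)" by simp
    have "emeasure (density (PiM I M) (\<lambda>x. \<Prod>i\<in>I. f i (x i))) (Pi\<^sub>E I A)
        = (\<integral>\<^sup>+x. (\<Prod>i\<in>I. f i (x i)) * indicator (Pi\<^sub>E I A) x \<partial>PiM I M)"
      using I A by (subst emeasure_density) (auto intro!: sets_PiM_I_finite)
    also have "\<dots> = (\<integral>\<^sup>+x. (\<Prod>i\<in>I. f i (x i) * indicator (A i) (x i)) \<partial>PiM I M)"
    proof (rule nn_integral_cong)
      fix x assume x: "x \<in> space (PiM I M)"
      show "(\<Prod>i\<in>I. f i (x i)) * indicator (Pi\<^sub>E I A) x = (\<Prod>i\<in>I. f i (x i) * indicator (A i) (x i))"
      proof (cases "x \<in> Pi\<^sub>E I A")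
        case True
        then show ?thesis by (auto intro!: prod.cong simp: PiE_iff)
      next
        case False
        then obtain i where "i \<in> I" "x i \<notin> A i"
          using x by (auto simp: space_PiM PiE_iff)
        then have "(\<Prod>i\<in>I. f i (x i) * indicator (A i) (x i)) = 0"
          using I by (intro prod_zero bexI[of _ i]) auto
        then show ?thesis using False by simp
      qed
    qed
    also have "\<dots> = (\<Prod>i\<in>I. \<integral>\<^sup>+x. f i x * indicator (A i) x \<partial>M i)"
      using A by (intro M.product_nn_integral_prod I) auto
    also have "\<dots> = (\<Prod>i\<in>I. emeasure (density (M i) (f i)) (A i))"
      using A by (intro prod.cong refl) (simp add: emeasure_density)
    finally show "emeasure (density (PiM I M) (\<lambda>x. \<Prod>i\<in>I. f i (x i))) (Pi\<^sub>E I A)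
        = (\<Prod>i\<in>I. emeasure (density (M i) (f i)) (A i))" .
  qed (fact I)
qed

lemma indep_vars_coordinates:
  assumes M: "\<And>i. i \<in> I \<Longrightarrow> prob_space (M i)" and I: "I \<noteq> {}"
  shows "prob_space.indep_vars (PiM I M) M (\<lambda>i x. x i) I"
proof -
  interpret prob_space "PiM I M" by (rule prob_space_PiM) (rule M)
  have "distr (PiM I M) (PiM I M) (\<lambda>x. \<lambda>i\<in>I. x i) = distr (PiM I M) (PiM I M) (\<lambda>x. x)"
    by (rule distr_cong) (auto simp: space_PiM PiE_iff extensional_restrict)
  also have "\<dots> = PiM I M" by (rule distr_id)
  also have "\<dots> = PiM I (\<lambda>i. distr (PiM I M) (M i) (\<lambda>x. x i))"
    by (rule PiM_cong) (simp_all add: distr_PiM_component M)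
  finally show ?thesis
    using I by (subst indep_vars_iff_distr_eq_PiM') auto
qed

section \<open>The Gaussian location model\<close>

definition gauss :: "real \<Rightarrow> real \<Rightarrow> real measure" where
  "gauss \<mu> s = density lborel (\<lambda>x. ennreal (normal_density \<mu> s x))"

lemma sets_gauss[simp, measurable_cong]: "sets (gauss \<mu> s) = sets borel"
  by (simp add: gauss_def)

lemma space_gauss[simp]: "space (gauss \<mu> s) = UNIV"
  by (simp add: gauss_def)

lemma prob_space_gauss: "s > 0 \<Longrightarrow> prob_space (gauss \<mu> s)"
  unfolding gauss_def by (rule prob_space_normal_density)

lemma gauss_eq_density:
  assumes "s > 0"
  shows "gauss \<mu> s = density (gauss 0 s) (\<lambda>x. ennreal (exp (\<mu> * x / s\<^sup>2 - \<mu>\<^sup>2 / (2 * s\<^sup>2))))"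
proof -
  have "normal_density \<mu> s x = normal_density 0 s x * exp (\<mu> * x / s\<^sup>2 - \<mu>\<^sup>2 / (2 * s\<^sup>2))" for x
  proof -
    have "- (x - \<mu>)\<^sup>2 / (2 * s\<^sup>2) = - (x - 0)\<^sup>2 / (2 * s\<^sup>2) + (\<mu> * x / s\<^sup>2 - \<mu>\<^sup>2 / (2 * s\<^sup>2))"
      using assms by (simp add: field_simps power2_eq_square)
    then have "exp (- (x - \<mu>)\<^sup>2 / (2 * s\<^sup>2))
        = exp (- (x - 0)\<^sup>2 / (2 * s\<^sup>2)) * exp (\<mu> * x / s\<^sup>2 - \<mu>\<^sup>2 / (2 * s\<^sup>2))"
      by (simp only: exp_add)
    then show ?thesis
      unfolding normal_density_def by (simp only: mult.assoc)
  qed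
  then show ?thesis
    unfolding gauss_def by (subst density_density_eq) (simp_all add: ennreal_mult')
qed

text \<open>
  After the substitution \<open>x = t + u\<close> the density at \<open>t + u\<close> is at most the density at \<open>u\<close> times
  \<open>exp (- t\<^sup>2 / (2 s\<^sup>2))\<close>, because the mixed term \<open>- t u / s\<^sup>2\<close> is negative; and by symmetry the
  half-line \<open>u > 0\<close> has mass at most 1/2. The factor 1/2 is what makes Gaussian laws admissible
  already for the tail constant \<open>C = 1/2\<close>.
\<close>

lemma gauss_tail:
  assumes s: "s > 0" and t: "t > 0"
  shows "measure (gauss 0 s) {t<..} \<le> 1/2 * exp (- (t\<^sup>2 / (2 * s\<^sup>2)))"
proof -
  interpret prob_space "gauss 0 s" using s by (rule prob_space_gauss)
  have meas[measurable]: "(\<lambda>x. ennreal (normal_density 0 s x)) \<in> borel_measurable borel" by simp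
  have em: "emeasure (gauss 0 s) A = (\<integral>\<^sup>+x. ennreal (normal_density 0 s x) * indicator A x \<partial>lborel)"
    if "A \<in> sets borel" for A
    unfolding gauss_def using that by (subst emeasure_density) auto
  have neg: "emeasure (gauss 0 s) {..<0} = emeasure (gauss 0 s) {0<..}"
    by (simp add: em, subst nn_integral_real_affine[where c="-1" and t=0])
      (auto intro!: nn_integral_cong split: split_indicator simp: normal_density_def)
  have "measure (gauss 0 s) {0<..} + measure (gauss 0 s) {..<0}
      = measure (gauss 0 s) ({0<..} \<union> {..<0})"
    by (rule finite_measure_Union[symmetric]) auto
  also have "\<dots> \<le> 1" by simp
  finally have half: "measure (gauss 0 s) {0<..} \<le> 1/2"
    using neg by (simp add: measure_def)
  have "emeasure (gauss 0 s) {t<..}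
      = (\<integral>\<^sup>+x. ennreal (normal_density 0 s (t + x)) * indicator {t<..} (t + x) \<partial>lborel)"
    by (subst em[OF borel_open[OF open_greaterThan]], subst nn_integral_real_affine[where c=1 and t=t])
      simp_all
  also have "\<dots> \<le> (\<integral>\<^sup>+x. ennreal (exp (- (t\<^sup>2 / (2 * s\<^sup>2))))
        * (ennreal (normal_density 0 s x) * indicator {0<..} x) \<partial>lborel)"
  proof (rule nn_integral_mono)
    fix x :: real
    have "normal_density 0 s (t + x) \<le> exp (- (t\<^sup>2 / (2 * s\<^sup>2))) * normal_density 0 s x" if "x > 0"
    proof -
      have "- (t + x - 0)\<^sup>2 / (2 * s\<^sup>2) \<le> - (t\<^sup>2 / (2 * s\<^sup>2)) + - (x - 0)\<^sup>2 / (2 * s\<^sup>2)"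
        using s t that by (simp add: field_simps power2_eq_square)
      then have "exp (- (t + x - 0)\<^sup>2 / (2 * s\<^sup>2))
          \<le> exp (- (t\<^sup>2 / (2 * s\<^sup>2))) * exp (- (x - 0)\<^sup>2 / (2 * s\<^sup>2))"
        by (simp flip: exp_add)
      then show ?thesis
        by (simp add: normal_density_def divide_right_mono)
    qed
    then show "ennreal (normal_density 0 s (t + x)) * indicator {t<..} (t + x)
        \<le> ennreal (exp (- (t\<^sup>2 / (2 * s\<^sup>2)))) * (ennreal (normal_density 0 s x) * indicator {0<..} x)"
      by (auto split: split_indicator simp flip: ennreal_mult' intro!: ennreal_leI)
  qed
  also have "\<dots> = ennreal (exp (- (t\<^sup>2 / (2 * s\<^sup>2)))) * emeasure (gauss 0 s) {0<..}"
    by (subst em[OF borel_open[OF open_greaterThan]], subst nn_integral_cmult) simp_all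
  also have "\<dots> \<le> ennreal (exp (- (t\<^sup>2 / (2 * s\<^sup>2)))) * ennreal (1/2)"
    by (rule mult_left_mono[OF ennreal_leI[OF half, folded emeasure_eq_measure]]) simp
  also have "\<dots> = ennreal (1/2 * exp (- (t\<^sup>2 / (2 * s\<^sup>2))))"
    by (subst ennreal_mult''[OF exp_ge_zero]) (rule mult.commute)
  finally show ?thesis
    by (simp add: emeasure_eq_measure)
qed

definition gauss_vec :: "nat \<Rightarrow> (nat \<Rightarrow> real) \<Rightarrow> real \<Rightarrow> (nat \<Rightarrow> real) measure" where
  "gauss_vec d \<mu> s = (\<Pi>\<^sub>M i\<in>{..<d}. gauss (\<mu> i) s)"

definition gauss_data ::
  "nat \<Rightarrow> nat \<Rightarrow> (nat \<Rightarrow> nat \<Rightarrow> real) \<Rightarrow> (nat \<Rightarrow> real) \<Rightarrow> (nat \<Rightarrow> nat \<Rightarrow> real) measure" where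
  "gauss_data d m \<theta> \<sigma> = (\<Pi>\<^sub>M k\<in>{0..m}. gauss_vec d (\<theta> k) (\<sigma> k))"

lemma sets_gauss_vec[simp, measurable_cong]: "sets (gauss_vec d \<mu> s) = sets (vec_space d)"
  unfolding gauss_vec_def vec_space_def by (rule sets_PiM_cong) simp_all

lemma sets_gauss_data[simp, measurable_cong]: "sets (gauss_data d m \<theta> \<sigma>) = sets (data_space d m)"
  unfolding gauss_data_def data_space_def by (rule sets_PiM_cong) simp_all

lemma prob_space_gauss_vec: "s > 0 \<Longrightarrow> prob_space (gauss_vec d \<mu> s)"
  unfolding gauss_vec_def by (intro prob_space_PiM prob_space_gauss)

lemma prob_space_gauss_data: "(\<And>k. \<sigma> k > 0) \<Longrightarrow> prob_space (gauss_data d m \<theta> \<sigma>)"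
  unfolding gauss_data_def by (intro prob_space_PiM prob_space_gauss_vec)

lemma measurable_vec_component:
  "i < d \<Longrightarrow> (\<lambda>x. x i) \<in> borel_measurable (vec_space d)"
  unfolding vec_space_def by (rule measurable_component_singleton) simp

lemma measurable_data_component:
  "k \<le> m \<Longrightarrow> (\<lambda>\<omega>. \<omega> k) \<in> data_space d m \<rightarrow>\<^sub>M vec_space d"
  unfolding data_space_def by (rule measurable_component_singleton) simp

lemma measurable_data_entry:
  "k \<le> m \<Longrightarrow> i < d \<Longrightarrow> (\<lambda>\<omega>. \<omega> k i) \<in> borel_measurable (data_space d m)"
  by (rule measurable_compose[OF measurable_data_component measurable_vec_component])

text \<open>The log-likelihood ratio of the means \<open>\<theta>\<close> against the means 0.\<close>

definition loglik :: "nat \<Rightarrow> nat \<Rightarrow> (nat \<Rightarrow> real) \<Rightarrow> (nat \<Rightarrow> nat \<Rightarrow> real) \<Rightarrow> (nat \<Rightarrow> nat \<Rightarrow> real) \<Rightarrow> real"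
  where "loglik d m \<sigma> \<theta> \<omega> =
    (\<Sum>k\<in>{0..m}. \<Sum>i<d. \<theta> k i * \<omega> k i / (\<sigma> k)\<^sup>2 - (\<theta> k i)\<^sup>2 / (2 * (\<sigma> k)\<^sup>2))"

lemma gauss_vec_eq_density:
  assumes s: "s > 0"
  shows "gauss_vec d \<mu> s = density (gauss_vec d (\<lambda>_. 0) s)
    (\<lambda>x. ennreal (exp (\<Sum>i<d. \<mu> i * x i / s\<^sup>2 - (\<mu> i)\<^sup>2 / (2 * s\<^sup>2))))"
proof -
  have "gauss_vec d \<mu> s = PiM {..<d} (\<lambda>i. density (gauss 0 s)
      (\<lambda>x. ennreal (exp (\<mu> i * x / s\<^sup>2 - (\<mu> i)\<^sup>2 / (2 * s\<^sup>2)))))"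
    unfolding gauss_vec_def by (rule PiM_cong) (simp_all add: gauss_eq_density[OF s, symmetric])
  also have "\<dots> = density (PiM {..<d} (\<lambda>_. gauss 0 s))
      (\<lambda>x. \<Prod>i<d. ennreal (exp (\<mu> i * x i / s\<^sup>2 - (\<mu> i)\<^sup>2 / (2 * s\<^sup>2))))"
  proof (rule PiM_density)
    show "sigma_finite_measure (gauss 0 s)"
      by (rule prob_space_imp_sigma_finite[OF prob_space_gauss[OF s]])
    show "sigma_finite_measure (density (gauss 0 s)
        (\<lambda>x. ennreal (exp (\<mu> i * x / s\<^sup>2 - (\<mu> i)\<^sup>2 / (2 * s\<^sup>2)))))" for i
      unfolding gauss_eq_density[OF s, symmetric]
      by (rule prob_space_imp_sigma_finite[OF prob_space_gauss[OF s]])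
    show "(\<lambda>x. ennreal (exp (\<mu> i * x / s\<^sup>2 - (\<mu> i)\<^sup>2 / (2 * s\<^sup>2))))
        \<in> borel_measurable (gauss 0 s)" for i
      by measurable
  qed simp
  also have "\<dots> = density (gauss_vec d (\<lambda>_. 0) s)
      (\<lambda>x. ennreal (exp (\<Sum>i<d. \<mu> i * x i / s\<^sup>2 - (\<mu> i)\<^sup>2 / (2 * s\<^sup>2))))"
    unfolding gauss_vec_def by (simp add: prod_ennreal exp_sum)
  finally show ?thesis .
qed

lemma gauss_data_eq_density:
  assumes \<sigma>: "\<And>k. \<sigma> k > 0"
  shows "gauss_data d m \<theta> \<sigma>
    = density (gauss_data d m (\<lambda>_ _. 0) \<sigma>) (\<lambda>\<omega>. ennreal (exp (loglik d m \<sigma> \<theta> \<omega>)))"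
proof -
  let ?l = "\<lambda>k x. ennreal (exp (\<Sum>i<d. \<theta> k i * x i / (\<sigma> k)\<^sup>2 - (\<theta> k i)\<^sup>2 / (2 * (\<sigma> k)\<^sup>2)))"
  have "gauss_data d m \<theta> \<sigma> = PiM {0..m} (\<lambda>k. density (gauss_vec d (\<lambda>_. 0) (\<sigma> k)) (?l k))"
    unfolding gauss_data_def by (rule PiM_cong) (simp_all add: gauss_vec_eq_density[OF \<sigma>, symmetric])
  also have "\<dots> = density (PiM {0..m} (\<lambda>k. gauss_vec d (\<lambda>_. 0) (\<sigma> k))) (\<lambda>\<omega>. \<Prod>k\<in>{0..m}. ?l k (\<omega> k))"
  proof (rule PiM_density)
    show "sigma_finite_measure (gauss_vec d (\<lambda>_. 0) (\<sigma> k))" for k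
      by (rule prob_space_imp_sigma_finite[OF prob_space_gauss_vec[OF \<sigma>]])
    show "sigma_finite_measure (density (gauss_vec d (\<lambda>_. 0) (\<sigma> k)) (?l k))" for k
      unfolding gauss_vec_eq_density[OF \<sigma>, symmetric]
      by (rule prob_space_imp_sigma_finite[OF prob_space_gauss_vec[OF \<sigma>]])
    show "?l k \<in> borel_measurable (gauss_vec d (\<lambda>_. 0) (\<sigma> k))" for k
    proof -
      have [measurable]: "(\<lambda>x. x i) \<in> borel_measurable (gauss_vec d (\<lambda>_. 0) (\<sigma> k))" if "i < d" for i
        using measurable_vec_component[OF that] by simp
      show ?thesis by measurable
    qed
  qed simp
  also have "\<dots> = density (gauss_data d m (\<lambda>_ _. 0) \<sigma>) (\<lambda>\<omega>. ennreal (exp (loglik d m \<sigma> \<theta> \<omega>)))"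
    unfolding gauss_data_def loglik_def by (simp add: prod_ennreal prod_nonneg exp_sum)
  finally show ?thesis .
qed

lemma measurable_loglik[measurable]:
  "loglik d m \<sigma> \<theta> \<in> borel_measurable (data_space d m)"
  unfolding loglik_def
  by (intro borel_measurable_sum borel_measurable_diff borel_measurable_divide borel_measurable_times
      borel_measurable_const measurable_data_entry) auto

text \<open>
  The moment generating function of independent centred Gaussians. It is the normalisation of a
  likelihood ratio: with means \<open>\<theta> k i = b k i * (\<sigma> k)\<^sup>2\<close> the linear form is \<open>loglik\<close> up to the constant on
  the right-hand side. Every second moment below reduces to this formula.
\<close>

lemma nn_integral_exp_linear:
  assumes \<sigma>: "\<And>k. \<sigma> k > 0"
  shows "(\<integral>\<^sup>+\<omega>. ennreal (exp (\<Sum>k\<in>{0..m}. \<Sum>i<d. b k i * \<omega> k i)) \<partial>gauss_data d m (\<lambda>_ _. 0) \<sigma>)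
    = ennreal (exp (\<Sum>k\<in>{0..m}. \<Sum>i<d. (b k i * \<sigma> k)\<^sup>2 / 2))"
proof -
  let ?P = "gauss_data d m (\<lambda>_ _. 0) \<sigma>"
  define \<theta> where "\<theta> k i = b k i * (\<sigma> k)\<^sup>2" for k i
  define c where "c = (\<Sum>k\<in>{0..m}. \<Sum>i<d. (b k i * \<sigma> k)\<^sup>2 / 2)"
  interpret prob_space "gauss_data d m \<theta> \<sigma>" by (rule prob_space_gauss_data) (rule \<sigma>)
  have eq: "(\<Sum>k\<in>{0..m}. \<Sum>i<d. b k i * \<omega> k i) = c + loglik d m \<sigma> \<theta> \<omega>" for \<omega>
    unfolding c_def loglik_def sum.distrib[symmetric] \<theta>_def
    using \<sigma> by (intro sum.cong refl)
      (simp add: field_simps power2_eq_square less_imp_neq[OF \<sigma>, symmetric])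
  have "(\<integral>\<^sup>+\<omega>. ennreal (exp (\<Sum>k\<in>{0..m}. \<Sum>i<d. b k i * \<omega> k i)) \<partial>?P)
      = (\<integral>\<^sup>+\<omega>. ennreal (exp c) * ennreal (exp (loglik d m \<sigma> \<theta> \<omega>)) \<partial>?P)"
    by (simp add: eq exp_add ennreal_mult')
  also have "\<dots> = ennreal (exp c) * (\<integral>\<^sup>+\<omega>. ennreal (exp (loglik d m \<sigma> \<theta> \<omega>)) \<partial>?P)"
    by (rule nn_integral_cmult) measurable
  also have "(\<integral>\<^sup>+\<omega>. ennreal (exp (loglik d m \<sigma> \<theta> \<omega>)) \<partial>?P) = (\<integral>\<^sup>+\<omega>. 1 \<partial>gauss_data d m \<theta> \<sigma>)"
    by (subst gauss_data_eq_density[OF \<sigma>], subst nn_integral_density) simp_all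
  also have "\<dots> = 1" using emeasure_space_1 by simp
  finally show ?thesis by (simp add: c_def)
qed

lemma has_bochner_integral_exp_linear:
  assumes \<sigma>: "\<And>k. \<sigma> k > 0"
  shows "has_bochner_integral (gauss_data d m (\<lambda>_ _. 0) \<sigma>)
    (\<lambda>\<omega>. exp (\<Sum>k\<in>{0..m}. \<Sum>i<d. b k i * \<omega> k i))
    (exp (\<Sum>k\<in>{0..m}. \<Sum>i<d. (b k i * \<sigma> k)\<^sup>2 / 2))"
proof (rule has_bochner_integral_nn_integral)
  have "(\<lambda>\<omega>. exp (\<Sum>k\<in>{0..m}. \<Sum>i<d. b k i * \<omega> k i)) \<in> borel_measurable (data_space d m)"
    by (intro borel_measurable_sum borel_measurable_times borel_measurable_const
        measurable_compose[OF _ borel_measurable_exp] measurable_data_entry) auto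
  then show "(\<lambda>\<omega>. exp (\<Sum>k\<in>{0..m}. \<Sum>i<d. b k i * \<omega> k i))
      \<in> borel_measurable (gauss_data d m (\<lambda>_ _. 0) \<sigma>)" by simp
qed (simp_all add: nn_integral_exp_linear[OF \<sigma>])

section \<open>Admissible Gaussian laws and the oracle rate\<close>

text \<open>
  A unit linear form of independent Gaussians with common variance is Gaussian with that variance,
  so the one-dimensional tail bound applies.
\<close>

lemma gauss_vec_tail:
  assumes s: "s > 0" and t: "t > 0" and a: "L2_set a {..<d} = 1"
  shows "measure (gauss_vec d \<mu> s) {x \<in> space (gauss_vec d \<mu> s). (\<Sum>i<d. a i * (x i - \<mu> i)) > t}
    \<le> 1/2 * exp (- (t\<^sup>2 / (2 * s\<^sup>2)))"
proof -
  let ?M = "gauss_vec d \<mu> s"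
  interpret prob_space ?M using s by (rule prob_space_gauss_vec)
  (* Coordinates with weight 0 are dropped: a degenerate normal law has no density. *)
  define I where "I = {i \<in> {..<d}. a i \<noteq> 0}"
  have I: "finite I" "I \<subseteq> {..<d}" by (auto simp: I_def)
  have norm: "(\<Sum>i\<in>I. (a i)\<^sup>2) = 1"
  proof -
    have "(\<Sum>i\<in>I. (a i)\<^sup>2) = (\<Sum>i<d. (a i)\<^sup>2)"
      by (rule sum.mono_neutral_left) (auto simp: I_def)
    then show ?thesis using a by (simp add: L2_set_def)
  qed
  then have "I \<noteq> {}" by auto
  let ?Y = "\<lambda>x. \<Sum>i\<in>I. a i * (x i - \<mu> i)"
  have coord: "distributed ?M lborel (\<lambda>x. x i) (normal_density (\<mu> i) s)" if i: "i \<in> I" for i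
  proof -
    have "distr ?M lborel (\<lambda>x. x i) = distr ?M (gauss (\<mu> i) s) (\<lambda>x. x i)"
      by (rule distr_cong) auto
    also have "\<dots> = gauss (\<mu> i) s"
      unfolding gauss_vec_def using i I s by (intro distr_PiM_component prob_space_gauss) auto
    finally show ?thesis
      unfolding distributed_def gauss_def
      using i I measurable_vec_component[of i d] by auto
  qed
  have "indep_vars (\<lambda>_. borel) (\<lambda>i x. x i) {..<d}"
  proof -
    have "{..<d} \<noteq> {}" using \<open>I \<noteq> {}\<close> I by auto
    then have "prob_space.indep_vars (PiM {..<d} (\<lambda>i. gauss (\<mu> i) s)) (\<lambda>i. gauss (\<mu> i) s) (\<lambda>i x. x i) {..<d}"
      by (intro indep_vars_coordinates prob_space_gauss s)
    then have "indep_vars (\<lambda>i. gauss (\<mu> i) s) (\<lambda>i x. x i) {..<d}"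
      by (simp only: gauss_vec_def)
    from indep_vars_compose2[OF this, of "\<lambda>_ x. x" "\<lambda>_. borel"] show ?thesis
      by simp
  qed
  then have "indep_vars (\<lambda>_. borel) (\<lambda>i x. x i) I"
    using I by (rule_tac indep_vars_subset) auto
  from indep_vars_compose2[OF this, of "\<lambda>i x. a i * (x - \<mu> i)" "\<lambda>_. borel"]
  have indep: "indep_vars (\<lambda>_. borel) (\<lambda>i x. a i * (x i - \<mu> i)) I"
    by simp
  have "distributed ?M lborel ?Y (normal_density (\<Sum>i\<in>I. 0) (sqrt (\<Sum>i\<in>I. (\<bar>a i\<bar> * s)\<^sup>2)))"
  proof (rule sum_indep_normal[OF I(1) \<open>I \<noteq> {}\<close> indep])
    fix i assume i: "i \<in> I"
    then have "a i \<noteq> 0" by (simp add: I_def)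
    then show "0 < \<bar>a i\<bar> * s" using s by simp
    from normal_density_affine[OF coord[OF i] s \<open>a i \<noteq> 0\<close>, of "- (a i * \<mu> i)"]
    show "distributed ?M lborel (\<lambda>x. a i * (x i - \<mu> i)) (normal_density 0 (\<bar>a i\<bar> * s))"
      by (simp add: algebra_simps)
  qed
  moreover have "sqrt (\<Sum>i\<in>I. (\<bar>a i\<bar> * s)\<^sup>2) = s"
    using norm s by (simp add: power_mult_distrib flip: sum_distrib_right)
  ultimately have Y: "distributed ?M lborel ?Y (normal_density 0 s)" by simp
  have "{x \<in> space ?M. (\<Sum>i<d. a i * (x i - \<mu> i)) > t} = ?Y -` {t<..} \<inter> space ?M"
  proof -
    have "(\<Sum>i<d. a i * (x i - \<mu> i)) = ?Y x" for x
      by (rule sum.mono_neutral_right) (auto simp: I_def)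
    then show ?thesis by auto
  qed
  then have "measure ?M {x \<in> space ?M. (\<Sum>i<d. a i * (x i - \<mu> i)) > t}
      = measure (distr ?M lborel ?Y) {t<..}"
    using distributed_measurable[OF Y] by (simp add: measure_distr)
  also have "distr ?M lborel ?Y = gauss 0 s"
    unfolding gauss_def by (rule distributed_distr_eq_density[OF Y])
  finally show ?thesis using gauss_tail[OF s t] by simp
qed

lemma gauss_data_admissible:
  assumes C: "C \<ge> 1/2" and \<tau>: "\<tau> > 0" and n: "\<And>k. n k \<ge> 1"
    and \<theta>: "\<And>k. k \<in> {0..m} \<Longrightarrow> \<theta> k \<in> space (vec_space d)"
    and h: "\<And>k. k \<in> {1..m} \<Longrightarrow> L2_set (\<lambda>i. \<theta> k i - \<theta> 0 i) {..<d} \<le> h k"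
  shows "admissible C d m h n \<tau> \<theta> (gauss_data d m \<theta> (\<lambda>k. \<tau> / sqrt (real (n k))))"
proof -
  define \<sigma> where "\<sigma> = (\<lambda>k. \<tau> / sqrt (real (n k)))"
  have npos: "real (n k) > 0" for k using n[of k] by simp
  then have \<sigma>: "\<sigma> k > 0" for k using \<tau> by (simp add: \<sigma>_def)
  let ?P = "gauss_data d m \<theta> \<sigma>"
  interpret prob_space ?P by (rule prob_space_gauss_data) (rule \<sigma>)
  have "indep_vars (\<lambda>k. gauss_vec d (\<theta> k) (\<sigma> k)) (\<lambda>k \<omega>. \<omega> k) {0..m}"
    using indep_vars_coordinates[of "{0..m}" "\<lambda>k. gauss_vec d (\<theta> k) (\<sigma> k)"] prob_space_gauss_vec[OF \<sigma>]
    by (simp add: gauss_data_def)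
  from indep_vars_compose2[OF this, of "\<lambda>_ x. x" "\<lambda>_. vec_space d"]
  have indep: "indep_vars (\<lambda>_. vec_space d) (\<lambda>k \<omega>. \<omega> k) {0..m}"
    by (simp add: measurable_cong_sets[OF sets_gauss_vec refl])
  have tail: "measure ?P {\<omega> \<in> space ?P. (\<Sum>i<d. a i * (\<omega> k i - \<theta> k i)) > t}
      \<le> C * exp (- (real (n k) * t\<^sup>2 / (2 * \<tau>\<^sup>2)))"
    if k: "k \<in> {0..m}" and t: "t > 0" and a: "L2_set a {..<d} = 1" for k t a
  proof -
    let ?N = "gauss_vec d (\<theta> k) (\<sigma> k)"
    let ?B = "{x \<in> space ?N. (\<Sum>i<d. a i * (x i - \<theta> k i)) > t}"
    have meas: "(\<lambda>\<omega>. \<omega> k) \<in> ?P \<rightarrow>\<^sub>M ?N"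
      unfolding gauss_data_def using k by (rule measurable_component_singleton)
    have "(\<lambda>x. \<Sum>i<d. a i * (x i - \<theta> k i)) \<in> borel_measurable (vec_space d)"
      by (intro borel_measurable_sum borel_measurable_times borel_measurable_diff
          borel_measurable_const measurable_vec_component) auto
    then have [measurable]: "(\<lambda>x. \<Sum>i<d. a i * (x i - \<theta> k i)) \<in> borel_measurable ?N" by simp
    have B: "?B \<in> sets ?N" by measurable
    have "{\<omega> \<in> space ?P. (\<Sum>i<d. a i * (\<omega> k i - \<theta> k i)) > t} = (\<lambda>\<omega>. \<omega> k) -` ?B \<inter> space ?P"
      using measurable_space[OF meas] by auto
    then have "measure ?P {\<omega> \<in> space ?P. (\<Sum>i<d. a i * (\<omega> k i - \<theta> k i)) > t}
        = measure (distr ?P ?N (\<lambda>\<omega>. \<omega> k)) ?B"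
      using measure_distr[OF meas B] by simp
    also have "distr ?P ?N (\<lambda>\<omega>. \<omega> k) = ?N"
      unfolding gauss_data_def using k \<sigma> by (intro distr_PiM_component prob_space_gauss_vec) auto
    also have "measure ?N ?B \<le> 1/2 * exp (- (t\<^sup>2 / (2 * (\<sigma> k)\<^sup>2)))"
      by (rule gauss_vec_tail[OF \<sigma> t a])
    also have "t\<^sup>2 / (2 * (\<sigma> k)\<^sup>2) = real (n k) * t\<^sup>2 / (2 * \<tau>\<^sup>2)"
      using npos[of k] \<tau> by (simp add: \<sigma>_def power_divide field_simps)
    also have "1/2 * exp (- (real (n k) * t\<^sup>2 / (2 * \<tau>\<^sup>2)))
        \<le> C * exp (- (real (n k) * t\<^sup>2 / (2 * \<tau>\<^sup>2)))"
      using C by (intro mult_right_mono) auto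
    finally show ?thesis .
  qed
  have "admissible C d m h n \<tau> \<theta> ?P"
    unfolding admissible_def
    using indep tail \<theta> h by (auto intro: prob_space_axioms)
  then show ?thesis by (simp add: \<sigma>_def)
qed

text \<open>
  The oracle may pool the target with any set of sources that share its parameter; the bias term of
  the rate vanishes for this choice.
\<close>

lemma oracle_rate_le:
  assumes A: "A \<subseteq> {1..m}" and h: "\<And>k. k \<in> A \<Longrightarrow> h k = 0"
  shows "oracle_rate d m h n \<tau> \<le> real d * \<tau>\<^sup>2 / (real (n 0) + (\<Sum>k\<in>A. real (n k)))"
proof -
  let ?S = "insert 0 A"
  have fin: "finite A" using A by (rule finite_subset) simp
  have "oracle_rate d m h n \<tau>
      \<le> real d * \<tau>\<^sup>2 / (\<Sum>k\<in>?S. real (n k)) + Max ((\<lambda>k. ((h(0 := 0)) k)\<^sup>2) ` ?S)"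
    unfolding oracle_rate_def
  proof (rule Min_le)
    have "{S. {0} \<subseteq> S \<and> S \<subseteq> {0..m}} \<subseteq> Pow {0..m}" by auto
    then have "finite {S. {0::nat} \<subseteq> S \<and> S \<subseteq> {0..m}}" by (rule finite_subset) simp
    then show "finite ((\<lambda>S. real d * \<tau>\<^sup>2 / (\<Sum>k\<in>S. real (n k)) + Max ((\<lambda>k. ((h(0 := 0)) k)\<^sup>2) ` S))
            ` {S. {0} \<subseteq> S \<and> S \<subseteq> {0..m}})" by (rule finite_imageI)
    have "?S \<in> {S. {0} \<subseteq> S \<and> S \<subseteq> {0..m}}" using A by auto
    then show "real d * \<tau>\<^sup>2 / (\<Sum>k\<in>?S. real (n k)) + Max ((\<lambda>k. ((h(0 := 0)) k)\<^sup>2) ` ?S)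
        \<in> (\<lambda>S. real d * \<tau>\<^sup>2 / (\<Sum>k\<in>S. real (n k)) + Max ((\<lambda>k. ((h(0 := 0)) k)\<^sup>2) ` S))
            ` {S. {0} \<subseteq> S \<and> S \<subseteq> {0..m}}" by (rule imageI)
  qed
  also have "(\<lambda>k. ((h(0 := 0)) k)\<^sup>2) ` ?S = {0}"
    using h by auto
  also have "(\<Sum>k\<in>?S. real (n k)) = real (n 0) + (\<Sum>k\<in>A. real (n k))"
    using A fin by (subst sum.insert) auto
  finally show ?thesis by simp
qed

section \<open>Sign vectors and a two-point inequality\<close>

text \<open>
  Vertices of the hypercube \<open>{-1, 1}\<^sup>A\<close> are encoded by the subsets of \<open>A\<close>, and an edge in direction
  \<open>i\<close> by the involution \<open>flip i\<close>.
\<close>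

definition sg :: "'a set \<Rightarrow> 'a \<Rightarrow> real" where
  "sg B i = (if i \<in> B then 1 else -1)"

definition flip :: "'a \<Rightarrow> 'a set \<Rightarrow> 'a set" where
  "flip i B = (if i \<in> B then B - {i} else insert i B)"

lemma sg_square[simp]: "(sg B i)\<^sup>2 = 1"
  by (simp add: sg_def)

lemma sg_flip: "sg (flip i B) j = (if j = i then - sg B j else sg B j)"
  by (cases "i \<in> B"; cases "j = i") (simp_all add: sg_def flip_def)

lemma flip_flip[simp]: "flip i (flip i B) = B"
  by (auto simp: flip_def)

lemma bij_betw_flip: "i \<in> A \<Longrightarrow> bij_betw (flip i) (Pow A) (Pow A)"
  by (rule bij_betw_byWitness[where f' = "flip i"]) (auto simp: flip_def split: if_splits)

text \<open>
  The pointwise core of the lower bound: \<open>f\<close> and \<open>g\<close> are the densities under two hypotheses with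
  parameters \<open>\<delta> e\<close> and \<open>- \<delta> e\<close>, and \<open>x\<close> is the estimate. For every \<open>x\<close> the weighted loss is at least
  \<open>4 \<delta>\<^sup>2 f g / (f + g)\<close>, which equals \<open>\<delta>\<^sup>2 (f + g - (f - g)\<^sup>2 / (f + g))\<close>; replacing the last denominator by \<open>g\<close>
  gives \<open>\<delta>\<^sup>2 (3 f - f\<^sup>2 / g)\<close>. Hence, if \<open>f\<close> has integral 1 and \<open>Q\<close> dominates \<open>f\<^sup>2 / g\<close> and has integral at most 2, then the two
  risks add up to at least \<open>\<delta>\<^sup>2\<close>.
\<close>

lemma two_point_pointwise:
  fixes x \<delta> e f g Q :: real
  assumes f: "f > 0" and g: "g > 0" and Q: "f\<^sup>2 \<le> Q * g" and e: "e\<^sup>2 = 1"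
  shows "3 * \<delta>\<^sup>2 * f \<le> (x - \<delta> * e)\<^sup>2 * f + (x + \<delta> * e)\<^sup>2 * g + \<delta>\<^sup>2 * Q"
proof -
  define y where "y = \<delta> * e"
  have y: "y\<^sup>2 = \<delta>\<^sup>2" using e by (simp add: y_def power_mult_distrib)
  (* Writing f = u g turns the claim into a polynomial identity with a sum of squares. *)
  define u where "u = f / g"
  have fu: "f = u * g" and u: "u > 0" using f g by (simp_all add: u_def)
  have "u * f \<le> Q" using Q g by (simp add: fu power2_eq_square mult.assoc[symmetric])
  let ?Z = "(x - y)\<^sup>2 * f + (x + y)\<^sup>2 * g + y\<^sup>2 * (u * f) - 3 * y\<^sup>2 * f"
  have "0 \<le> (f * (x - y) + g * (x + y))\<^sup>2 + y\<^sup>2 * u * (f - g)\<^sup>2"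
    using u by simp
  also have "\<dots> = (f + g) * ?Z"
    unfolding fu power2_eq_square by (simp only: algebra_simps)
  finally have "0 \<le> ?Z"
    using zero_le_mult_iff[of "f + g" ?Z] f g by linarith
  moreover have "y\<^sup>2 * (u * f) \<le> y\<^sup>2 * Q"
    using \<open>u * f \<le> Q\<close> by (intro mult_left_mono) auto
  ultimately have "3 * y\<^sup>2 * f \<le> (x - y)\<^sup>2 * f + (x + y)\<^sup>2 * g + y\<^sup>2 * Q"
    by linarith
  then show ?thesis
    unfolding y unfolding y_def .
qed

text \<open>
  A substitute for \<open>f\<^sup>2 / g = 2 f - g + (f - g)\<^sup>2 / g\<close> that is quadratic in \<open>f\<close> and \<open>g\<close>. When \<open>f\<close> and \<open>g\<close> are
  mixtures of exponentials, its integral is explicit, while that of the quotient is not.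
\<close>

lemma square_le_quadratic_majorant:
  fixes f g c :: real
  assumes "c > 0" and "1 \<le> c * g"
  shows "f\<^sup>2 \<le> (2 * f - g + c * (f - g)\<^sup>2) * g"
proof -
  have "(f - g)\<^sup>2 * 1 \<le> (f - g)\<^sup>2 * (c * g)"
    using assms by (intro mult_left_mono) auto
  then show ?thesis by (simp add: algebra_simps power2_eq_square)
qed

section \<open>Sources that mask the target\<close>

text \<open>
  The target parameter is \<open>\<delta>\<close> times a vertex of the hypercube in the first \<open>a\<close> coordinates, and 0 in
  the others. Sources come in \<open>p\<close> pairs \<open>(k, k + p)\<close>: one member of each pair has the parameter of the
  target, the other one its negative, and a hidden sign decides which is which. The remaining sources
  have parameter 0. The standard deviations are \<open>s0\<close> for the target and \<open>s\<close> for the sources.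
  Pairing fixes the number of aligned sources at \<open>p\<close>, so that the oracle rate is the same for all
  configurations.
\<close>

locale masked_sources =
  fixes d m p a :: nat and \<delta> s0 s :: real
  assumes a: "a \<le> d" and p: "2 * p \<le> m"
    and \<delta>: "\<delta> > 0" and s0: "s0 > 0" and s: "s > 0"
begin

definition \<sigma> :: "nat \<Rightarrow> real" where
  "\<sigma> k = (if k = 0 then s0 else s)"

text \<open>
  The signal-to-noise ratio of one coordinate of one source.
\<close>

definition \<kappa> :: real where
  "\<kappa> = \<delta>\<^sup>2 / s\<^sup>2"

text \<open>
  Domain \<open>k\<close> has parameter \<open>role T k\<close> times that of the target; the set \<open>T\<close> consists of the pairs whose
  first member is aligned with the target.
\<close>

definition role :: "nat set \<Rightarrow> nat \<Rightarrow> real" where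
  "role T k = (if k = 0 then 1 else if k \<le> p then sg T k else if k \<le> 2 * p then - sg T (k - p) else 0)"

text \<open>
  Restricting to \<open>{..<d}\<close> makes the parameters elements of \<open>space (vec_space d)\<close>.
\<close>

definition \<theta> :: "nat set \<Rightarrow> nat set \<Rightarrow> nat \<Rightarrow> nat \<Rightarrow> real" where
  "\<theta> B T k = (\<lambda>i\<in>{..<d}. if i < a then \<delta> * role T k * sg B i else 0)"

abbreviation P0 :: "(nat \<Rightarrow> nat \<Rightarrow> real) measure" where
  "P0 \<equiv> gauss_data d m (\<lambda>_ _. 0) \<sigma>"

definition target_score :: "nat set \<Rightarrow> (nat \<Rightarrow> nat \<Rightarrow> real) \<Rightarrow> real" where
  "target_score B \<omega> = (\<Sum>i<a. \<delta> * sg B i / s0\<^sup>2 * \<omega> 0 i)"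

definition pair_score :: "nat set \<Rightarrow> nat \<Rightarrow> (nat \<Rightarrow> nat \<Rightarrow> real) \<Rightarrow> real" where
  "pair_score B k \<omega> = (\<Sum>i<a. \<delta> * sg B i / s\<^sup>2 * (\<omega> k i - \<omega> (k + p) i))"

definition pair_lr :: "nat set \<Rightarrow> nat \<Rightarrow> (nat \<Rightarrow> nat \<Rightarrow> real) \<Rightarrow> real" where
  "pair_lr B k \<omega> = exp (- (real a * \<kappa>)) * cosh (pair_score B k \<omega>)"

definition target_lr :: "nat set \<Rightarrow> (nat \<Rightarrow> nat \<Rightarrow> real) \<Rightarrow> real" where
  "target_lr B \<omega> = exp (target_score B \<omega> - real a * \<delta>\<^sup>2 / (2 * s0\<^sup>2))"

text \<open>
  The likelihood ratio of the data against the means 0 once the hidden signs are averaged out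
  uniformly: a sign turns \<open>exp (\<plusminus> pair_score)\<close> into \<open>cosh pair_score\<close> by averaging, independently over
  the pairs.
\<close>

definition mix_lr :: "nat set \<Rightarrow> (nat \<Rightarrow> nat \<Rightarrow> real) \<Rightarrow> real" where
  "mix_lr B \<omega> = target_lr B \<omega> * (\<Prod>k=1..p. pair_lr B k \<omega>)"

lemma \<sigma>_pos: "\<sigma> k > 0"
  using s0 s by (simp add: \<sigma>_def)

sublocale P0: prob_space P0
  by (rule prob_space_gauss_data) (rule \<sigma>_pos)

lemma sum_active: "(\<Sum>i<d. if i < a then F i else 0) = (\<Sum>i<a. F i)"
  for F :: "nat \<Rightarrow> real"
proof -
  have "(\<Sum>i<d. if i < a then F i else 0) = (\<Sum>i\<in>{i\<in>{..<d}. i < a}. F i)"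
    by (rule sum.inter_filter[symmetric]) simp
  also have "{i\<in>{..<d}. i < a} = {..<a}" using a by auto
  finally show ?thesis .
qed

lemma sum_domains:
  fixes F :: "nat \<Rightarrow> real"
  assumes "\<And>k. k > 2 * p \<Longrightarrow> F k = 0"
  shows "(\<Sum>k\<in>{0..m}. F k) = F 0 + (\<Sum>k=1..p. F k + F (k + p))"
proof -
  have "(\<Sum>k\<in>{0..m}. F k) = (\<Sum>k\<in>insert 0 ({1..p} \<union> {1+p..p+p}). F k)"
  proof (rule sum.mono_neutral_right)
    show "\<forall>k\<in>{0..m} - insert 0 ({1..p} \<union> {1+p..p+p}). F k = 0"
    proof
      fix k assume "k \<in> {0..m} - insert 0 ({1..p} \<union> {1+p..p+p})"
      then have "k > 2 * p" by auto
      then show "F k = 0" by (rule assms)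
    qed
  qed (use p in auto)
  also have "\<dots> = F 0 + ((\<Sum>k=1..p. F k) + (\<Sum>k\<in>{1+p..p+p}. F k))"
    by (subst sum.insert) (auto simp: sum.union_disjoint)
  also have "(\<Sum>k\<in>{1+p..p+p}. F k) = (\<Sum>k=1..p. F (k + p))"
    by (rule sum.shift_bounds_cl_nat_ivl)
  finally show ?thesis by (simp add: sum.distrib)
qed

lemma loglik_\<theta>:
  "loglik d m \<sigma> (\<theta> B T) \<omega> = (target_score B \<omega> - real a * \<delta>\<^sup>2 / (2 * s0\<^sup>2))
     + (\<Sum>k=1..p. sg T k * pair_score B k \<omega> - real a * \<kappa>)"
proof -
  define F where "F k = (\<Sum>i<a. \<delta> * role T k * sg B i * \<omega> k i / (\<sigma> k)\<^sup>2)
      - real a * (\<delta> * role T k)\<^sup>2 / (2 * (\<sigma> k)\<^sup>2)" for k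
  have "loglik d m \<sigma> (\<theta> B T) \<omega> = (\<Sum>k\<in>{0..m}. F k)"
    unfolding loglik_def
  proof (rule sum.cong[OF refl])
    fix k
    have "(\<Sum>i<d. \<theta> B T k i * \<omega> k i / (\<sigma> k)\<^sup>2 - (\<theta> B T k i)\<^sup>2 / (2 * (\<sigma> k)\<^sup>2))
        = (\<Sum>i<d. if i < a then \<delta> * role T k * sg B i * \<omega> k i / (\<sigma> k)\<^sup>2
            - (\<delta> * role T k)\<^sup>2 / (2 * (\<sigma> k)\<^sup>2) else 0)"
      by (intro sum.cong refl) (auto simp: \<theta>_def power_mult_distrib)
    also have "\<dots> = F k"
      by (subst sum_active) (simp add: F_def sum_subtractf)
    finally show "(\<Sum>i<d. \<theta> B T k i * \<omega> k i / (\<sigma> k)\<^sup>2 - (\<theta> B T k i)\<^sup>2 / (2 * (\<sigma> k)\<^sup>2)) = F k" .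
  qed
  also have "\<dots> = F 0 + (\<Sum>k=1..p. F k + F (k + p))"
    by (rule sum_domains) (simp add: F_def role_def)
  also have "F 0 = target_score B \<omega> - real a * \<delta>\<^sup>2 / (2 * s0\<^sup>2)"
    by (simp add: F_def role_def \<sigma>_def target_score_def)
  also have "(\<Sum>k=1..p. F k + F (k + p)) = (\<Sum>k=1..p. sg T k * pair_score B k \<omega> - real a * \<kappa>)"
  proof (rule sum.cong[OF refl])
    fix k assume k: "k \<in> {1..p}"
    have r: "role T k = sg T k" "role T (k + p) = - sg T k" "\<sigma> k = s" "\<sigma> (k + p) = s"
      using k by (auto simp: role_def \<sigma>_def)
    have "sg T k * pair_score B k \<omega> = (\<Sum>i<a. \<delta> * sg T k * sg B i * \<omega> k i / s\<^sup>2)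
        + (\<Sum>i<a. \<delta> * - sg T k * sg B i * \<omega> (k + p) i / s\<^sup>2)"
      unfolding pair_score_def sum_distrib_left sum.distrib[symmetric]
      by (intro sum.cong refl) (simp add: right_diff_distrib diff_divide_distrib mult_ac)
    moreover have "real a * (\<delta> * sg T k)\<^sup>2 / (2 * s\<^sup>2) + real a * (\<delta> * - sg T k)\<^sup>2 / (2 * s\<^sup>2)
        = real a * \<kappa>"
      by (simp add: \<kappa>_def power_mult_distrib)
    ultimately show "F k + F (k + p) = sg T k * pair_score B k \<omega> - real a * \<kappa>"
      unfolding F_def r by linarith
  qed
  finally show ?thesis .
qed

text \<open>
  Expanding a product of binomials into a sum over subsets identifies the average over all hidden
  signs with a product over pairs.
\<close>

lemma average_lr:
  "(\<Sum>T\<in>Pow {1..p}. exp (loglik d m \<sigma> (\<theta> B T) \<omega>)) = 2 ^ p * mix_lr B \<omega>"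
proof -
  define y where "y k = pair_score B k \<omega>" for k
  have "exp (loglik d m \<sigma> (\<theta> B T) \<omega>)
      = target_lr B \<omega> * ((\<Prod>k\<in>T. exp (y k - a * \<kappa>)) * (\<Prod>k\<in>{1..p} - T. exp (- y k - a * \<kappa>)))"
    if T: "T \<in> Pow {1..p}" for T
  proof -
    have "(\<Prod>k\<in>{1..p}. exp (sg T k * y k - a * \<kappa>))
        = (\<Prod>k\<in>{1..p} - T. exp (sg T k * y k - a * \<kappa>)) * (\<Prod>k\<in>T. exp (sg T k * y k - a * \<kappa>))"
      using T by (intro prod.subset_diff) auto
    also have "\<dots> = (\<Prod>k\<in>{1..p} - T. exp (- y k - a * \<kappa>)) * (\<Prod>k\<in>T. exp (y k - a * \<kappa>))"
      by (intro arg_cong2[where f="(*)"] prod.cong refl) (auto simp: sg_def)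
    finally have *: "(\<Prod>k\<in>{1..p}. exp (sg T k * y k - a * \<kappa>))
        = (\<Prod>k\<in>T. exp (y k - a * \<kappa>)) * (\<Prod>k\<in>{1..p} - T. exp (- y k - a * \<kappa>))"
      by (simp only: mult.commute)
    have "exp (loglik d m \<sigma> (\<theta> B T) \<omega>)
        = target_lr B \<omega> * exp (\<Sum>k\<in>{1..p}. sg T k * y k - a * \<kappa>)"
      unfolding loglik_\<theta> target_lr_def y_def by (rule exp_add)
    then show ?thesis
      by (simp only: exp_sum[OF finite_atLeastAtMost] *)
  qed
  then have "(\<Sum>T\<in>Pow {1..p}. exp (loglik d m \<sigma> (\<theta> B T) \<omega>))
      = target_lr B \<omega> * (\<Sum>T\<in>Pow {1..p}. (\<Prod>k\<in>T. exp (y k - a * \<kappa>)) * (\<Prod>k\<in>{1..p} - T. exp (- y k - a * \<kappa>)))"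
    unfolding sum_distrib_left by (rule sum.cong[OF refl])
  also have "(\<Sum>T\<in>Pow {1..p}. (\<Prod>k\<in>T. exp (y k - a * \<kappa>)) * (\<Prod>k\<in>{1..p} - T. exp (- y k - a * \<kappa>)))
      = (\<Prod>k=1..p. exp (y k - a * \<kappa>) + exp (- y k - a * \<kappa>))"
    by (rule prod_add[symmetric]) simp
  also have "\<dots> = (\<Prod>k=1..p. 2 * pair_lr B k \<omega>)"
  proof (rule prod.cong[OF refl])
    fix k
    have "exp (y k - a * \<kappa>) = exp (- (a * \<kappa>)) * exp (y k)"
      "exp (- y k - a * \<kappa>) = exp (- (a * \<kappa>)) * exp (- y k)"
      by (simp_all flip: exp_add)
    then show "exp (y k - a * \<kappa>) + exp (- y k - a * \<kappa>) = 2 * pair_lr B k \<omega>"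
      by (simp add: pair_lr_def y_def cosh_field_def distrib_left)
  qed
  also have "target_lr B \<omega> * (\<Prod>k=1..p. 2 * pair_lr B k \<omega>) = 2 ^ p * mix_lr B \<omega>"
    by (simp add: mix_lr_def prod.distrib)
  finally show ?thesis .
qed

lemma mix_lr_pos: "mix_lr B \<omega> > 0"
  unfolding mix_lr_def target_lr_def pair_lr_def by (intro mult_pos_pos prod_pos) auto

lemma measurable_mix_lr[measurable]: "mix_lr B \<in> borel_measurable (data_space d m)"
proof -
  have "mix_lr B = (\<lambda>\<omega>. (\<Sum>T\<in>Pow {1..p}. exp (loglik d m \<sigma> (\<theta> B T) \<omega>)) / 2 ^ p)"
    by (simp add: average_lr fun_eq_iff del: One_nat_def)
  also have "\<dots> \<in> borel_measurable (data_space d m)" by measurable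
  finally show ?thesis .
qed

lemma nn_integral_average:
  assumes [measurable]: "F \<in> borel_measurable (data_space d m)"
  shows "(\<Sum>T\<in>Pow {1..p}. \<integral>\<^sup>+\<omega>. F \<omega> \<partial>gauss_data d m (\<theta> B T) \<sigma>)
    = 2 ^ p * (\<integral>\<^sup>+\<omega>. ennreal (mix_lr B \<omega>) * F \<omega> \<partial>P0)"
proof -
  have "(\<Sum>T\<in>Pow {1..p}. \<integral>\<^sup>+\<omega>. F \<omega> \<partial>gauss_data d m (\<theta> B T) \<sigma>)
      = (\<Sum>T\<in>Pow {1..p}. \<integral>\<^sup>+\<omega>. ennreal (exp (loglik d m \<sigma> (\<theta> B T) \<omega>)) * F \<omega> \<partial>P0)"
    by (subst gauss_data_eq_density[OF \<sigma>_pos]) (simp add: nn_integral_density)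
  also have "\<dots> = (\<integral>\<^sup>+\<omega>. (\<Sum>T\<in>Pow {1..p}. ennreal (exp (loglik d m \<sigma> (\<theta> B T) \<omega>)) * F \<omega>) \<partial>P0)"
    by (rule nn_integral_sum[symmetric]) measurable
  also have "\<dots> = (\<integral>\<^sup>+\<omega>. 2 ^ p * (ennreal (mix_lr B \<omega>) * F \<omega>) \<partial>P0)"
  proof (rule nn_integral_cong)
    fix \<omega>
    have "(\<Sum>T\<in>Pow {1..p}. ennreal (exp (loglik d m \<sigma> (\<theta> B T) \<omega>)) * F \<omega>)
        = ennreal (\<Sum>T\<in>Pow {1..p}. exp (loglik d m \<sigma> (\<theta> B T) \<omega>)) * F \<omega>"
      by (simp flip: sum_distrib_right)
    also have "\<dots> = ennreal (2 ^ p) * ennreal (mix_lr B \<omega>) * F \<omega>"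
      unfolding average_lr by (subst ennreal_mult') auto
    finally show "(\<Sum>T\<in>Pow {1..p}. ennreal (exp (loglik d m \<sigma> (\<theta> B T) \<omega>)) * F \<omega>)
        = 2 ^ p * (ennreal (mix_lr B \<omega>) * F \<omega>)" by (simp add: mult.assoc flip: ennreal_power)
  qed
  also have "\<dots> = 2 ^ p * (\<integral>\<^sup>+\<omega>. ennreal (mix_lr B \<omega>) * F \<omega> \<partial>P0)"
    by (rule nn_integral_cmult) measurable
  finally show ?thesis .
qed

lemma nn_integral_mix_lr: "(\<integral>\<^sup>+\<omega>. ennreal (mix_lr B \<omega>) \<partial>P0) = 1"
proof -
  have "2 ^ p * (\<integral>\<^sup>+\<omega>. ennreal (mix_lr B \<omega>) * 1 \<partial>P0)
      = (\<Sum>T\<in>Pow {1..p}. \<integral>\<^sup>+\<omega>. 1 \<partial>gauss_data d m (\<theta> B T) \<sigma>)"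
    by (rule nn_integral_average[symmetric]) simp
  also have "\<dots> = (\<Sum>T\<in>Pow {1..p}. 1)"
    using prob_space.emeasure_space_1[OF prob_space_gauss_data[OF \<sigma>_pos]] by simp
  also have "\<dots> = 2 ^ p * 1"
    by (simp add: card_Pow)
  finally have "2 ^ p * (\<integral>\<^sup>+\<omega>. ennreal (mix_lr B \<omega>) * 1 \<partial>P0) = 2 ^ p * (1::ennreal)" .
  then show ?thesis
    by (subst (asm) ennreal_mult_cancel_left) (simp add: power_eq_top_ennreal)
qed

end

section \<open>Chi-square divergence of neighbouring mixtures\<close>

lemma rescale_square: "s\<^sup>2 * (x / s\<^sup>2)\<^sup>2 = x\<^sup>2 / s\<^sup>2" if "s > 0" for x s :: real
  using that by (simp add: power_divide power2_eq_square)

context masked_sources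
begin

lemma pair_mgf:
  assumes k: "k \<in> {1..p}"
  shows "has_bochner_integral P0 (\<lambda>\<omega>. exp (\<Sum>i<a. c i * (\<omega> k i - \<omega> (k + p) i)))
    (exp (s\<^sup>2 * (\<Sum>i<a. (c i)\<^sup>2)))"
proof -
  have kp: "k \<noteq> k + p" "k \<le> m" "k + p \<le> m" "0 < k" using k p by auto
  define b where "b k' i = (if i < a then (if k' = k then c i else if k' = k + p then - c i else 0) else 0)" for k' i
  have two: "(\<Sum>k'\<in>{0..m}. \<Sum>i<d. F k' i) = (\<Sum>i<a. F k i + F (k + p) i)"
    if F: "\<And>k' i. b k' i = 0 \<Longrightarrow> F k' i = 0" for F :: "nat \<Rightarrow> nat \<Rightarrow> real"
  proof -
    have "(\<Sum>k'\<in>{0..m}. \<Sum>i<d. F k' i) = (\<Sum>k'\<in>{k, k + p}. \<Sum>i<d. F k' i)"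
      using kp by (intro sum.mono_neutral_right) (auto intro!: sum.neutral F simp: b_def)
    also have "\<dots> = (\<Sum>k'\<in>{k, k + p}. \<Sum>i<a. F k' i)"
      using a by (intro sum.cong[OF refl] sum.mono_neutral_right) (auto intro!: F simp: b_def)
    finally show ?thesis using kp by (simp add: sum.distrib)
  qed
  have "(\<Sum>k'\<in>{0..m}. \<Sum>i<d. b k' i * \<omega> k' i) = (\<Sum>i<a. c i * (\<omega> k i - \<omega> (k + p) i))" for \<omega>
    using kp by (subst two) (auto intro!: sum.cong simp: b_def right_diff_distrib)
  moreover have "(\<Sum>k'\<in>{0..m}. \<Sum>i<d. (b k' i * \<sigma> k')\<^sup>2 / 2) = s\<^sup>2 * (\<Sum>i<a. (c i)\<^sup>2)"
    unfolding sum_distrib_left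
    using kp by (subst two) (auto intro!: sum.cong simp: b_def \<sigma>_def power_mult_distrib)
  ultimately show ?thesis
    using has_bochner_integral_exp_linear[where \<sigma> = \<sigma> and d = d and m = m and b = b, OF \<sigma>_pos] by simp
qed

lemma target_mgf:
  "has_bochner_integral P0 (\<lambda>\<omega>. exp (\<Sum>i<a. c i * \<omega> 0 i)) (exp (s0\<^sup>2 * (\<Sum>i<a. (c i)\<^sup>2) / 2))"
proof -
  define b where "b k' i = (if i < a then (if k' = 0 then c i else 0) else 0)" for k' i :: nat
  have one: "(\<Sum>k'\<in>{0..m}. \<Sum>i<d. F k' i) = (\<Sum>i<a. F 0 i)"
    if F: "\<And>k' i. b k' i = 0 \<Longrightarrow> F k' i = 0" for F :: "nat \<Rightarrow> nat \<Rightarrow> real"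
  proof -
    have "(\<Sum>k'\<in>{0..m}. \<Sum>i<d. F k' i) = (\<Sum>k'\<in>{0}. \<Sum>i<d. F k' i)"
      by (intro sum.mono_neutral_right) (auto intro!: sum.neutral F simp: b_def)
    also have "\<dots> = (\<Sum>k'\<in>{0}. \<Sum>i<a. F k' i)"
      using a by (intro sum.cong[OF refl] sum.mono_neutral_right) (auto intro!: F simp: b_def)
    finally show ?thesis by simp
  qed
  have "(\<Sum>k'\<in>{0..m}. \<Sum>i<d. b k' i * \<omega> k' i) = (\<Sum>i<a. c i * \<omega> 0 i)" for \<omega>
    by (subst one) (auto intro!: sum.cong simp: b_def)
  moreover have "(\<Sum>k'\<in>{0..m}. \<Sum>i<d. (b k' i * \<sigma> k')\<^sup>2 / 2) = s0\<^sup>2 * (\<Sum>i<a. (c i)\<^sup>2) / 2"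
    unfolding sum_distrib_left sum_divide_distrib
    by (subst one) (auto intro!: sum.cong simp: b_def \<sigma>_def power_mult_distrib)
  ultimately show ?thesis
    using has_bochner_integral_exp_linear[where \<sigma> = \<sigma> and d = d and m = m and b = b, OF \<sigma>_pos] by (simp only:)
qed

lemma pair_cosh:
  assumes k: "k \<in> {1..p}"
  shows "has_bochner_integral P0 (\<lambda>\<omega>. cosh (\<Sum>i<a. c i * (\<omega> k i - \<omega> (k + p) i)))
    (exp (s\<^sup>2 * (\<Sum>i<a. (c i)\<^sup>2)))"
proof -
  have "has_bochner_integral P0 (\<lambda>\<omega>. (exp (\<Sum>i<a. c i * (\<omega> k i - \<omega> (k + p) i))
        + exp (\<Sum>i<a. - c i * (\<omega> k i - \<omega> (k + p) i))) / 2)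
      ((exp (s\<^sup>2 * (\<Sum>i<a. (c i)\<^sup>2)) + exp (s\<^sup>2 * (\<Sum>i<a. (- c i)\<^sup>2))) / 2)"
    by (intro has_bochner_integral_divide_zero has_bochner_integral_add pair_mgf k)
  then show ?thesis
    by (simp add: cosh_field_def sum_negf)
qed

lemma pair_score_cosh:
  assumes k: "k \<in> {1..p}"
  shows "has_bochner_integral P0 (\<lambda>\<omega>. cosh (pair_score B k \<omega>)) (exp (a * \<kappa>))"
proof -
  have "s\<^sup>2 * (\<Sum>i<a. (\<delta> * sg B i / s\<^sup>2)\<^sup>2) = a * \<kappa>"
    using s unfolding sum_distrib_left by (simp add: \<kappa>_def rescale_square power_mult_distrib)
  then show ?thesis
    using pair_cosh[OF k, of "\<lambda>i. \<delta> * sg B i / s\<^sup>2"] by (simp add: pair_score_def)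
qed

text \<open>
  The second moments of the mixtures, from \<open>2 cosh x cosh y = cosh (x + y) + cosh (x - y)\<close>.
\<close>

lemma pair_score_cosh_product:
  assumes k: "k \<in> {1..p}"
  shows "has_bochner_integral P0 (\<lambda>\<omega>. cosh (pair_score B k \<omega>) * cosh (pair_score B' k \<omega>))
    ((exp (\<kappa> * (\<Sum>i<a. (sg B i + sg B' i)\<^sup>2)) + exp (\<kappa> * (\<Sum>i<a. (sg B i - sg B' i)\<^sup>2))) / 2)"
proof -
  define c1 where "c1 i = \<delta> * (sg B i + sg B' i) / s\<^sup>2" for i
  define c2 where "c2 i = \<delta> * (sg B i - sg B' i) / s\<^sup>2" for i
  have lin: "(\<Sum>i<a. c1 i * (\<omega> k i - \<omega> (k + p) i)) = pair_score B k \<omega> + pair_score B' k \<omega>"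
    "(\<Sum>i<a. c2 i * (\<omega> k i - \<omega> (k + p) i)) = pair_score B k \<omega> - pair_score B' k \<omega>" for \<omega>
    unfolding pair_score_def c1_def c2_def sum.distrib[symmetric] sum_subtractf[symmetric]
    by (auto intro!: sum.cong simp: algebra_simps add_divide_distrib diff_divide_distrib)
  have var: "s\<^sup>2 * (\<Sum>i<a. (c1 i)\<^sup>2) = \<kappa> * (\<Sum>i<a. (sg B i + sg B' i)\<^sup>2)"
    "s\<^sup>2 * (\<Sum>i<a. (c2 i)\<^sup>2) = \<kappa> * (\<Sum>i<a. (sg B i - sg B' i)\<^sup>2)"
    using s unfolding sum_distrib_left c1_def c2_def \<kappa>_def
    by (auto intro!: sum.cong simp: rescale_square power_mult_distrib)
  have prod: "cosh x * cosh y = (cosh (x + y) + cosh (x - y)) / 2" for x y :: real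
    by (simp add: cosh_add cosh_diff)
  show ?thesis
    unfolding prod using pair_cosh[OF k, of c1] pair_cosh[OF k, of c2]
    unfolding lin var by (intro has_bochner_integral_divide_zero has_bochner_integral_add)
qed

text \<open>
  Upper bounds for \<open>f\<^sup>2 / g\<close>, where \<open>f\<close> and \<open>g\<close> are the likelihood ratios for the vertices \<open>B\<close> and \<open>B'\<close>. The
  factor of the target is this quotient itself; the factor of a pair is the quadratic substitute,
  with \<open>exp (a * \<kappa>)\<close> bounding \<open>1 / g\<close> because \<open>cosh \<ge> 1\<close>.
\<close>

definition pair_majorant :: "nat set \<Rightarrow> nat set \<Rightarrow> nat \<Rightarrow> (nat \<Rightarrow> nat \<Rightarrow> real) \<Rightarrow> real" where
  "pair_majorant B B' k \<omega> = 2 * pair_lr B k \<omega> - pair_lr B' k \<omega>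
     + exp (a * \<kappa>) * (pair_lr B k \<omega> - pair_lr B' k \<omega>)\<^sup>2"

definition target_majorant :: "nat set \<Rightarrow> nat set \<Rightarrow> (nat \<Rightarrow> nat \<Rightarrow> real) \<Rightarrow> real" where
  "target_majorant B B' \<omega>
     = exp (2 * target_score B \<omega> - target_score B' \<omega> - real a * \<delta>\<^sup>2 / (2 * s0\<^sup>2))"

definition majorant :: "nat set \<Rightarrow> nat set \<Rightarrow> (nat \<Rightarrow> nat \<Rightarrow> real) \<Rightarrow> real" where
  "majorant B B' \<omega> = target_majorant B B' \<omega> * (\<Prod>k=1..p. pair_majorant B B' k \<omega>)"

lemma pair_lr_pos: "pair_lr B k \<omega> > 0"
  by (simp add: pair_lr_def)

lemma pair_lr_square_le: "(pair_lr B k \<omega>)\<^sup>2 \<le> pair_majorant B B' k \<omega> * pair_lr B' k \<omega>"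
  unfolding pair_majorant_def
proof (rule square_le_quadratic_majorant)
  show "1 \<le> exp (a * \<kappa>) * pair_lr B' k \<omega>"
    unfolding pair_lr_def mult.assoc[symmetric] exp_add[symmetric] by (simp add: cosh_real_ge_1)
qed simp

lemma pair_majorant_nonneg: "pair_majorant B B' k \<omega> \<ge> 0"
proof -
  have "0 \<le> pair_majorant B B' k \<omega> * pair_lr B' k \<omega>"
    using pair_lr_square_le[of B k \<omega> B'] zero_le_power2[of "pair_lr B k \<omega>"] by linarith
  then show ?thesis using pair_lr_pos[of B' k \<omega>] by (simp add: zero_le_mult_iff)
qed

lemma majorant_nonneg: "majorant B B' \<omega> \<ge> 0"
  unfolding majorant_def target_majorant_def
  by (intro mult_nonneg_nonneg prod_nonneg) (auto simp: pair_majorant_nonneg)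

lemma mix_lr_square_le: "(mix_lr B \<omega>)\<^sup>2 \<le> majorant B B' \<omega> * mix_lr B' \<omega>"
proof -
  have "(target_lr B \<omega>)\<^sup>2 = target_majorant B B' \<omega> * target_lr B' \<omega>"
    unfolding target_lr_def target_majorant_def by (simp add: power2_eq_square flip: exp_add)
  moreover have "(\<Prod>k=1..p. pair_lr B k \<omega>)\<^sup>2
      \<le> (\<Prod>k=1..p. pair_majorant B B' k \<omega>) * (\<Prod>k=1..p. pair_lr B' k \<omega>)"
  proof -
    have "(\<Prod>k=1..p. (pair_lr B k \<omega>)\<^sup>2) \<le> (\<Prod>k=1..p. pair_majorant B B' k \<omega> * pair_lr B' k \<omega>)"
      by (rule prod_mono) (use pair_lr_square_le in auto)
    then show ?thesis by (simp only: prod.distrib prod_power_distrib)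
  qed
  ultimately have "(mix_lr B \<omega>)\<^sup>2 \<le> target_majorant B B' \<omega> * target_lr B' \<omega>
      * ((\<Prod>k=1..p. pair_majorant B B' k \<omega>) * (\<Prod>k=1..p. pair_lr B' k \<omega>))"
    unfolding mix_lr_def power_mult_distrib
    by (metis mult_left_mono zero_le_power2)
  then show ?thesis
    unfolding mix_lr_def majorant_def by (simp only: mult_ac)
qed

lemma sum_flip:
  assumes i: "i < a"
  shows "(\<Sum>j<a. (sg B j + sg (flip i B) j)\<^sup>2) = 4 * (real a - 1)"
    and "(\<Sum>j<a. (sg B j - sg (flip i B) j)\<^sup>2) = 4"
    and "(\<Sum>j<a. (2 * sg B j - sg (flip i B) j)\<^sup>2) = a + 8"
proof -
  have sg: "sg B j = 1 \<or> sg B j = -1" for j by (simp add: sg_def)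
  have sum: "(\<Sum>j<a. if j = i then u else v) = u + v * (real a - 1)" for u v :: real
    using i by (subst sum.remove[of _ i]) (auto simp: mult.commute of_nat_diff)
  have "(\<Sum>j<a. (sg B j + sg (flip i B) j)\<^sup>2) = (\<Sum>j<a. if j = i then 0 else 4)"
    by (intro sum.cong refl) (use sg in \<open>auto simp: sg_flip\<close>)
  then show "(\<Sum>j<a. (sg B j + sg (flip i B) j)\<^sup>2) = 4 * (real a - 1)" by (simp add: sum)
  have "(\<Sum>j<a. (sg B j - sg (flip i B) j)\<^sup>2) = (\<Sum>j<a. if j = i then 4 else 0)"
    by (intro sum.cong refl) (use sg in \<open>auto simp: sg_flip\<close>)
  then show "(\<Sum>j<a. (sg B j - sg (flip i B) j)\<^sup>2) = 4" by (simp add: sum)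
  have "(\<Sum>j<a. (2 * sg B j - sg (flip i B) j)\<^sup>2) = (\<Sum>j<a. if j = i then 9 else 1)"
    by (intro sum.cong refl) (use sg in \<open>auto simp: sg_flip\<close>)
  then show "(\<Sum>j<a. (2 * sg B j - sg (flip i B) j)\<^sup>2) = a + 8" by (simp add: sum)
qed

text \<open>
  The excess over 1 bounds the chi-square divergence, within one pair, between two vertices joined by
  an edge. It is at most of order \<open>a * \<kappa>\<^sup>2\<close> for bounded \<open>a * \<kappa>\<close>. For \<open>a = 1\<close> it vanishes, since a global change of sign
  is absorbed by the hidden signs: in one active coordinate the sources carry no information on the
  target at any signal strength.
\<close>

definition pair_cost :: real where
  "pair_cost = 1 + exp (- (a * \<kappa>)) * ((exp (4 * \<kappa>) - 1) * (exp (4 * (real a - 1) * \<kappa>) - 1))"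

lemma pair_majorant_integral:
  assumes k: "k \<in> {1..p}" and i: "i < a"
  shows "(\<integral>\<^sup>+\<omega>. ennreal (pair_majorant B (flip i B) k \<omega>) \<partial>P0) = ennreal pair_cost"
proof -
  let ?B' = "flip i B"
  let ?c = "\<lambda>B \<omega>. cosh (pair_score B k \<omega>)"
  define E where "E = exp (- (real a * \<kappa>))"
  have Einv: "exp (real a * \<kappa>) * E = 1" by (simp add: E_def flip: exp_add)
  have eq: "pair_majorant B ?B' k \<omega> = E * (2 * ?c B \<omega> - ?c ?B' \<omega>
      + (?c B \<omega> * ?c B \<omega> - 2 * (?c B \<omega> * ?c ?B' \<omega>) + ?c ?B' \<omega> * ?c ?B' \<omega>))" for \<omega>
  proof -
    have "exp (a * \<kappa>) * (E * ?c B \<omega> - E * ?c ?B' \<omega>)\<^sup>2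
        = (exp (a * \<kappa>) * E) * (E * (?c B \<omega> - ?c ?B' \<omega>)\<^sup>2)"
      by (simp add: algebra_simps power2_eq_square)
    then show ?thesis
      unfolding pair_majorant_def pair_lr_def E_def[symmetric] Einv
      by (simp add: algebra_simps power2_eq_square)
  qed
  have same: "(\<Sum>i<a. (sg B i + sg B i)\<^sup>2) = 4 * real a" "(\<Sum>i<a. (sg B i - sg B i)\<^sup>2) = 0" for B
    by (simp_all add: power_mult_distrib flip: mult_2)
  let ?q = "(exp (\<kappa> * (4 * real a)) + exp (\<kappa> * 0)) / 2"
  let ?r = "(exp (\<kappa> * (4 * (real a - 1))) + exp (\<kappa> * 4)) / 2"
  have "has_bochner_integral P0 (pair_majorant B ?B' k)
      (E * (2 * exp (a * \<kappa>) - exp (a * \<kappa>) + (?q - 2 * ?r + ?q)))"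
    unfolding eq
    using pair_score_cosh_product[OF k, of B B] pair_score_cosh_product[OF k, of ?B' ?B']
      pair_score_cosh_product[OF k, of B ?B', unfolded sum_flip[OF i]]
    unfolding same
    by (intro has_bochner_integral_mult_right has_bochner_integral_add has_bochner_integral_diff
        pair_score_cosh k)
  moreover have "E * (2 * exp (a * \<kappa>) - exp (a * \<kappa>) + (?q - 2 * ?r + ?q)) = pair_cost"
  proof -
    have "exp (\<kappa> * 4) * exp (\<kappa> * (4 * (real a - 1))) = exp (\<kappa> * (4 * real a))"
      by (simp add: algebra_simps flip: exp_add)
    then show ?thesis
      unfolding pair_cost_def using Einv by (simp add: E_def algebra_simps)
  qed
  ultimately show ?thesis
    using nn_integral_eq_integral[of P0 "pair_majorant B ?B' k"]
    by (simp add: has_bochner_integral_iff pair_majorant_nonneg)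
qed

text \<open>
  The target observes \<open>\<delta>\<close> against \<open>- \<delta>\<close> in one coordinate, which has chi-square divergence
  \<open>exp (4 \<delta>\<^sup>2 / s0\<^sup>2) - 1\<close>.
\<close>

lemma target_majorant_integral:
  assumes i: "i < a"
  shows "(\<integral>\<^sup>+\<omega>. ennreal (target_majorant B (flip i B) \<omega>) \<partial>P0) = ennreal (exp (4 * \<delta>\<^sup>2 / s0\<^sup>2))"
proof -
  let ?B' = "flip i B"
  define c where "c j = \<delta> * (2 * sg B j - sg ?B' j) / s0\<^sup>2" for j
  define E where "E = exp (- (real a * \<delta>\<^sup>2 / (2 * s0\<^sup>2)))"
  have "(\<Sum>j<a. c j * \<omega> 0 j) = 2 * target_score B \<omega> - target_score ?B' \<omega>" for \<omega>
    unfolding target_score_def c_def sum_distrib_left sum_subtractf[symmetric]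
    by (auto intro!: sum.cong simp: algebra_simps diff_divide_distrib)
  then have eq: "target_majorant B ?B' = (\<lambda>\<omega>. exp (\<Sum>j<a. c j * \<omega> 0 j) * E)"
    by (simp add: fun_eq_iff target_majorant_def E_def flip: exp_add)
  have "s0\<^sup>2 * (\<Sum>j<a. (c j)\<^sup>2) = \<delta>\<^sup>2 / s0\<^sup>2 * (\<Sum>j<a. (2 * sg B j - sg ?B' j)\<^sup>2)"
    using s0 unfolding sum_distrib_left c_def
    by (auto intro!: sum.cong simp: rescale_square power_mult_distrib)
  also have "\<dots> = \<delta>\<^sup>2 / s0\<^sup>2 * (a + 8)" by (simp add: sum_flip[OF i])
  finally have var: "s0\<^sup>2 * (\<Sum>j<a. (c j)\<^sup>2) = \<delta>\<^sup>2 / s0\<^sup>2 * (a + 8)" .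
  have "has_bochner_integral P0 (target_majorant B ?B') (exp (\<delta>\<^sup>2 / s0\<^sup>2 * (a + 8) / 2) * E)"
    unfolding eq using target_mgf[of c, unfolded var] by (rule has_bochner_integral_mult_left)
  moreover have "exp (\<delta>\<^sup>2 / s0\<^sup>2 * (a + 8) / 2) * E = exp (4 * \<delta>\<^sup>2 / s0\<^sup>2)"
    using s0 by (simp add: E_def field_simps flip: exp_add)
  ultimately show ?thesis
    using nn_integral_eq_integral[of P0 "target_majorant B ?B'"]
    by (simp add: has_bochner_integral_iff target_majorant_def)
qed

text \<open>
  Under the means 0 the target and the \<open>p\<close> pairs of sources are independent blocks, so that the
  integral of the product factorises.
\<close>

lemma majorant_integral:
  assumes i: "i < a"
  shows "(\<integral>\<^sup>+\<omega>. ennreal (majorant B (flip i B) \<omega>) \<partial>P0)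
    = ennreal (exp (4 * \<delta>\<^sup>2 / s0\<^sup>2) * pair_cost ^ p)"
proof -
  let ?B' = "flip i B"
  define K where "K j = (if j = 0 then {0} else {j, j + p})" for j
  define Y where "Y j = (if j = 0 then target_majorant B ?B' else pair_majorant B ?B' j)" for j
  have K: "K j \<subseteq> {0..m}" if "j \<in> {0..p}" for j
    using that p by (auto simp: K_def)
  have disj: "disjoint_family_on K {0..p}"
    by (auto simp: disjoint_family_on_def K_def)
  have Y_restrict: "Y j (restrict \<omega> (K j)) = Y j \<omega>" for j \<omega>
    by (simp add: Y_def K_def target_majorant_def target_score_def pair_majorant_def pair_lr_def
        pair_score_def)
  have entry: "(\<lambda>x. x k i') \<in> borel_measurable (PiM J (\<lambda>_. vec_space d))" if "k \<in> J" "i' < a"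
    for J :: "nat set" and k i'
  proof (rule measurable_compose[where N = "vec_space d"])
    show "(\<lambda>x. x k) \<in> PiM J (\<lambda>_. vec_space d) \<rightarrow>\<^sub>M vec_space d"
      using that by (intro measurable_component_singleton)
    show "(\<lambda>x. x i') \<in> borel_measurable (vec_space d)"
      using that a by (intro measurable_vec_component) auto
  qed
  have Y_meas: "Y j \<in> borel_measurable (PiM (K j) (\<lambda>_. vec_space d))" for j
  proof (cases "j = 0")
    case True
    have [measurable]: "(\<lambda>x. x (0::nat) i') \<in> borel_measurable (PiM {0} (\<lambda>_. vec_space d))" if "i' < a" for i'
      by (rule entry) (use that in auto)
    show ?thesis
      unfolding Y_def K_def using True
      by (simp add: target_majorant_def[abs_def] target_score_def) measurable
  next
    case False
    have [measurable]: "(\<lambda>x. x j i') \<in> borel_measurable (PiM {j, j + p} (\<lambda>_. vec_space d))"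
      "(\<lambda>x. x (j + p) i') \<in> borel_measurable (PiM {j, j + p} (\<lambda>_. vec_space d))" if "i' < a" for i'
      by (rule entry; use that in auto)+
    have [measurable]: "pair_score B'' j \<in> borel_measurable (PiM {j, j + p} (\<lambda>_. vec_space d))" for B''
      unfolding pair_score_def[abs_def] by measurable
    have [measurable]: "pair_lr B'' j \<in> borel_measurable (PiM {j, j + p} (\<lambda>_. vec_space d))" for B''
      unfolding pair_lr_def[abs_def] cosh_field_def by measurable
    show ?thesis
      unfolding Y_def K_def using False
      by (simp add: pair_majorant_def[abs_def]) measurable
  qed
  have "prob_space.indep_vars P0 (\<lambda>k. gauss_vec d (\<lambda>_. 0) (\<sigma> k)) (\<lambda>k \<omega>. \<omega> k) {0..m}"
    unfolding gauss_data_def by (intro indep_vars_coordinates prob_space_gauss_vec \<sigma>_pos) simp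
  from P0.indep_vars_compose2[OF this, of "\<lambda>_ x. x" "\<lambda>_. vec_space d"]
  have "P0.indep_vars (\<lambda>_. vec_space d) (\<lambda>k \<omega>. \<omega> k) {0..m}"
    by (simp add: measurable_cong_sets[OF sets_gauss_vec refl])
  from P0.indep_vars_restrict[OF this K disj]
  have "P0.indep_vars (\<lambda>j. PiM (K j) (\<lambda>_. vec_space d)) (\<lambda>j \<omega>. restrict \<omega> (K j)) {0..p}"
    by simp
  from P0.indep_vars_compose2[OF this, of "\<lambda>j x. ennreal (Y j x)" "\<lambda>_. borel"]
  have "P0.indep_vars (\<lambda>_. borel) (\<lambda>j \<omega>. ennreal (Y j \<omega>)) {0..p}"
    using Y_meas by (simp add: Y_restrict)
  from P0.indep_vars_nn_integral[OF _ this]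
  have prod: "(\<integral>\<^sup>+\<omega>. (\<Prod>j\<in>{0..p}. ennreal (Y j \<omega>)) \<partial>P0)
      = (\<Prod>j\<in>{0..p}. \<integral>\<^sup>+\<omega>. ennreal (Y j \<omega>) \<partial>P0)"
    by simp
  have split: "(\<Prod>j\<in>{0..p}. F j) = F 0 * (\<Prod>j=1..p. F j)" for F :: "nat \<Rightarrow> ennreal"
    by (simp add: prod.atLeast_Suc_atMost)
  have cost: "pair_cost \<ge> 0"
    using i by (intro order_trans[OF zero_le_one]) (simp add: pair_cost_def \<kappa>_def)
  have "(\<integral>\<^sup>+\<omega>. ennreal (majorant B ?B' \<omega>) \<partial>P0) = (\<integral>\<^sup>+\<omega>. (\<Prod>j\<in>{0..p}. ennreal (Y j \<omega>)) \<partial>P0)"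
    unfolding split
    by (intro nn_integral_cong)
      (simp add: majorant_def Y_def target_majorant_def pair_majorant_nonneg prod_nonneg prod_ennreal
        ennreal_mult)
  also have "\<dots> = (\<Prod>j\<in>{0..p}. \<integral>\<^sup>+\<omega>. ennreal (Y j \<omega>) \<partial>P0)" by (rule prod)
  also have "\<dots> = ennreal (exp (4 * \<delta>\<^sup>2 / s0\<^sup>2)) * (\<Prod>k=1..p. ennreal pair_cost)"
    unfolding split
    by (intro arg_cong2[where f="(*)"] prod.cong)
      (simp_all add: Y_def target_majorant_integral[OF i] pair_majorant_integral[OF _ i])
  also have "\<dots> = ennreal (exp (4 * \<delta>\<^sup>2 / s0\<^sup>2) * pair_cost ^ p)"
    by (simp add: cost ennreal_power ennreal_mult)
  finally show ?thesis .
qed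

section \<open>Averaging over the hypercube\<close>

lemma two_point_bound:
  assumes i: "i < a" and budget: "exp (4 * \<delta>\<^sup>2 / s0\<^sup>2) * pair_cost ^ p \<le> 2"
    and x[measurable]: "x \<in> borel_measurable (data_space d m)"
  shows "ennreal (\<delta>\<^sup>2) \<le>
      (\<integral>\<^sup>+\<omega>. ennreal (mix_lr B \<omega>) * ennreal ((x \<omega> - \<delta> * sg B i)\<^sup>2) \<partial>P0)
    + (\<integral>\<^sup>+\<omega>. ennreal (mix_lr (flip i B) \<omega>) * ennreal ((x \<omega> - \<delta> * sg (flip i B) i)\<^sup>2) \<partial>P0)"
    (is "_ \<le> ?I")
proof -
  let ?B' = "flip i B"
  have [measurable]: "majorant B ?B' \<in> borel_measurable (data_space d m)"
  proof -
    have entry: "(\<lambda>\<omega>. \<omega> k i') \<in> borel_measurable (data_space d m)" if "k \<le> m" "i' < a" for k i'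
      using that a by (intro measurable_data_entry) auto
    have [measurable]: "target_score B'' \<in> borel_measurable (data_space d m)" for B''
      unfolding target_score_def[abs_def]
      by (intro borel_measurable_sum borel_measurable_times borel_measurable_const entry) auto
    have [measurable]: "pair_score B'' k \<in> borel_measurable (data_space d m)" if "k \<in> {1..p}" for B'' k
      unfolding pair_score_def[abs_def] using that p
      by (intro borel_measurable_sum borel_measurable_times borel_measurable_diff
          borel_measurable_const entry) auto
    have [measurable]: "pair_lr B'' k \<in> borel_measurable (data_space d m)" if "k \<in> {1..p}" for B'' k
      unfolding pair_lr_def[abs_def] cosh_field_def using that by measurable
    show ?thesis
      unfolding majorant_def[abs_def] target_majorant_def pair_majorant_def by measurable
  qed
  have "ennreal (2 * \<delta>\<^sup>2) + ennreal (\<delta>\<^sup>2) = ennreal (3 * \<delta>\<^sup>2)"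
    by (subst ennreal_plus[symmetric]) simp_all
  also have "\<dots> = (\<integral>\<^sup>+\<omega>. ennreal (3 * \<delta>\<^sup>2) * ennreal (mix_lr B \<omega>) \<partial>P0)"
    by (subst nn_integral_cmult) (simp_all add: nn_integral_mix_lr ennreal_mult)
  also have "\<dots> \<le> (\<integral>\<^sup>+\<omega>. ennreal (mix_lr B \<omega>) * ennreal ((x \<omega> - \<delta> * sg B i)\<^sup>2)
      + ennreal (mix_lr ?B' \<omega>) * ennreal ((x \<omega> - \<delta> * sg ?B' i)\<^sup>2)
      + ennreal (\<delta>\<^sup>2) * ennreal (majorant B ?B' \<omega>) \<partial>P0)"
  proof (rule nn_integral_mono)
    fix \<omega>
    have "3 * \<delta>\<^sup>2 * mix_lr B \<omega> \<le> (x \<omega> - \<delta> * sg B i)\<^sup>2 * mix_lr B \<omega>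
        + (x \<omega> + \<delta> * sg B i)\<^sup>2 * mix_lr ?B' \<omega> + \<delta>\<^sup>2 * majorant B ?B' \<omega>"
      by (intro two_point_pointwise mix_lr_pos mix_lr_square_le sg_square)
    then have "3 * \<delta>\<^sup>2 * mix_lr B \<omega> \<le> mix_lr B \<omega> * (x \<omega> - \<delta> * sg B i)\<^sup>2
        + mix_lr ?B' \<omega> * (x \<omega> - \<delta> * sg ?B' i)\<^sup>2 + \<delta>\<^sup>2 * majorant B ?B' \<omega>"
      by (simp add: sg_flip mult.commute)
    then show "ennreal (3 * \<delta>\<^sup>2) * ennreal (mix_lr B \<omega>)
        \<le> ennreal (mix_lr B \<omega>) * ennreal ((x \<omega> - \<delta> * sg B i)\<^sup>2)
        + ennreal (mix_lr ?B' \<omega>) * ennreal ((x \<omega> - \<delta> * sg ?B' i)\<^sup>2)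
        + ennreal (\<delta>\<^sup>2) * ennreal (majorant B ?B' \<omega>)"
      using mix_lr_pos[of B \<omega>] mix_lr_pos[of ?B' \<omega>] majorant_nonneg[of B ?B' \<omega>]
      by (simp add: ennreal_leI less_imp_le flip: ennreal_mult ennreal_plus)
  qed
  also have "\<dots> = ?I + ennreal (\<delta>\<^sup>2) * (\<integral>\<^sup>+\<omega>. ennreal (majorant B ?B' \<omega>) \<partial>P0)"
    by (simp add: nn_integral_add nn_integral_cmult)
  also have "\<dots> \<le> ?I + ennreal (\<delta>\<^sup>2) * ennreal 2"
    unfolding majorant_integral[OF i]
    by (intro add_left_mono mult_left_mono ennreal_leI[OF budget]) simp
  also have "\<dots> = ennreal (2 * \<delta>\<^sup>2) + ?I"
    by (subst ennreal_mult[symmetric]) (simp_all add: mult.commute add.commute)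
  finally show ?thesis
    by (simp only: ennreal_add_left_cancel_le) simp
qed

text \<open>
  Assouad's argument: in each of the \<open>a\<close> active coordinates the average over the vertices is an
  average over the edges in that direction, and each edge contributes at least \<open>\<delta>\<^sup>2\<close> to the sum of the
  risks at its ends. The bound holds for the average over all vertices and hidden signs, hence for a
  uniform bound \<open>r\<close>.
\<close>

lemma hypercube_bound:
  assumes budget: "exp (4 * \<delta>\<^sup>2 / s0\<^sup>2) * pair_cost ^ p \<le> 2"
    and est: "est \<in> data_space d m \<rightarrow>\<^sub>M vec_space d"
    and risk: "\<And>B T. (\<integral>\<^sup>+\<omega>. ennreal ((L2_set (\<lambda>i. est \<omega> i - \<theta> B T 0 i) {..<d})\<^sup>2)
        \<partial>gauss_data d m (\<theta> B T) \<sigma>) \<le> r"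
  shows "ennreal (a * \<delta>\<^sup>2 / 2) \<le> r"
proof -
  have x[measurable]: "(\<lambda>\<omega>. est \<omega> i) \<in> borel_measurable (data_space d m)" if "i < a" for i
    using that a by (intro measurable_compose[OF est measurable_vec_component]) auto
  define X where "X i B = (\<integral>\<^sup>+\<omega>. ennreal (mix_lr B \<omega>) * ennreal ((est \<omega> i - \<delta> * sg B i)\<^sup>2) \<partial>P0)" for i B
  have per_vertex: "2 ^ p * (\<Sum>i<a. X i B) \<le> 2 ^ p * r" for B
  proof -
    define F where "F \<omega> = ennreal (\<Sum>i<a. (est \<omega> i - \<delta> * sg B i)\<^sup>2)" for \<omega>
    have [measurable]: "F \<in> borel_measurable (data_space d m)"
      unfolding F_def[abs_def] by measurable
    have "F \<omega> \<le> ennreal ((L2_set (\<lambda>i. est \<omega> i - \<theta> B T 0 i) {..<d})\<^sup>2)" for \<omega> T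
    proof -
      have "(\<Sum>i<a. (est \<omega> i - \<delta> * sg B i)\<^sup>2) = (\<Sum>i<a. (est \<omega> i - \<theta> B T 0 i)\<^sup>2)"
        using a by (intro sum.cong refl) (simp add: \<theta>_def role_def)
      also have "\<dots> \<le> (\<Sum>i<d. (est \<omega> i - \<theta> B T 0 i)\<^sup>2)"
        using a by (intro sum_mono2) auto
      finally show ?thesis
        by (simp add: F_def L2_set_def sum_nonneg ennreal_leI)
    qed
    then have "(\<integral>\<^sup>+\<omega>. F \<omega> \<partial>gauss_data d m (\<theta> B T) \<sigma>) \<le> r" for T
      by (intro order_trans[OF nn_integral_mono risk])
    then have "(\<Sum>T\<in>Pow {1..p}. \<integral>\<^sup>+\<omega>. F \<omega> \<partial>gauss_data d m (\<theta> B T) \<sigma>) \<le> (\<Sum>T\<in>Pow {1..p}. r)"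
      by (intro sum_mono)
    also have "\<dots> = 2 ^ p * r" by (simp add: card_Pow)
    finally have "2 ^ p * (\<integral>\<^sup>+\<omega>. ennreal (mix_lr B \<omega>) * F \<omega> \<partial>P0) \<le> 2 ^ p * r"
      by (simp only: nn_integral_average[OF \<open>F \<in> borel_measurable (data_space d m)\<close>])
    also have "(\<integral>\<^sup>+\<omega>. ennreal (mix_lr B \<omega>) * F \<omega> \<partial>P0) = (\<Sum>i<a. X i B)"
      unfolding X_def F_def
      by (subst nn_integral_sum[symmetric])
        (auto simp: sum_distrib_left simp flip: sum_ennreal intro!: nn_integral_cong)
    finally show ?thesis .
  qed
  have pair: "ennreal (2 ^ a * \<delta>\<^sup>2) \<le> 2 * (\<Sum>B\<in>Pow {..<a}. X i B)" if i: "i < a" for i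
  proof -
    have "ennreal (2 ^ a * \<delta>\<^sup>2) = (\<Sum>B\<in>Pow {..<a}. ennreal (\<delta>\<^sup>2))"
      by (simp add: card_Pow ennreal_mult flip: ennreal_power)
    also have "\<dots> \<le> (\<Sum>B\<in>Pow {..<a}. X i B + X i (flip i B))"
      unfolding X_def by (intro sum_mono two_point_bound[OF i budget x[OF i]])
    also have "\<dots> = (\<Sum>B\<in>Pow {..<a}. X i B) + (\<Sum>B\<in>Pow {..<a}. X i (flip i B))"
      by (rule sum.distrib)
    also have "(\<Sum>B\<in>Pow {..<a}. X i (flip i B)) = (\<Sum>B\<in>Pow {..<a}. X i B)"
      using i by (intro sum.reindex_bij_betw bij_betw_flip) simp
    finally show ?thesis by (simp add: mult_2)
  qed
  have "ennreal (a * (2 ^ a * \<delta>\<^sup>2)) = (\<Sum>i<a. ennreal (2 ^ a * \<delta>\<^sup>2))"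
    by (simp add: ennreal_mult ennreal_of_nat_eq_real_of_nat)
  also have "\<dots> \<le> (\<Sum>i<a. 2 * (\<Sum>B\<in>Pow {..<a}. X i B))"
    by (intro sum_mono pair) simp
  also have "\<dots> = 2 * (\<Sum>B\<in>Pow {..<a}. \<Sum>i<a. X i B)"
    by (subst sum.swap) (simp add: sum_distrib_left)
  also have "\<dots> \<le> 2 * (\<Sum>B\<in>Pow {..<a}. r)"
  proof (intro mult_left_mono sum_mono)
    fix B
    show "(\<Sum>i<a. X i B) \<le> r"
      using per_vertex[of B] by (subst (asm) ennreal_mult_le_mult_iff) (auto simp: power_eq_top_ennreal)
  qed simp
  also have "\<dots> = ennreal (2 ^ Suc a) * r"
    by (simp add: card_Pow mult.assoc ennreal_mult flip: ennreal_power)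
  finally have "ennreal (2 ^ Suc a * (a * \<delta>\<^sup>2 / 2)) \<le> ennreal (2 ^ Suc a) * r"
    by (simp add: mult_ac)
  then show ?thesis
    by (subst (asm) ennreal_mult, simp, simp, subst (asm) ennreal_mult_le_mult_iff) auto
qed

end

section \<open>From the risk to the intrinsic cost\<close>

lemma divide_ennreal_antimono:
  fixes x :: ennreal
  assumes "R \<le> S"
  shows "x / ennreal S \<le> x / ennreal R"
proof (cases "R > 0")
  case True
  then show ?thesis
    using assms unfolding divide_ennreal_def
    by (intro mult_left_mono) (simp_all add: inverse_ennreal ennreal_leI le_imp_inverse_le)
next
  case False
  then show ?thesis by (simp add: ennreal_neg)
qed

text \<open>
  For each configuration the similarity levels \<open>h\<close> are the exact distances of the sources from the
  target, so \<open>h\<close> vanishes on \<open>p\<close> sources and the oracle rate is at most that of pooling these with the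
  target. The hypothesis \<open>len\<close> keeps all distances, which are at most \<open>2 \<delta> sqrt a\<close>, below 1. The hypotheses
  \<open>target\<close> and \<open>pairs\<close> bound the two factors of the chi-square term by \<open>exp (1/4)\<close> each, and
  \<open>exp (1/2) \<le> 2\<close>.
\<close>

lemma intrinsic_cost_ge:
  fixes d m p a n n0 :: nat and \<delta> \<tau> C :: real
  assumes C: "C \<ge> 1/2" and \<tau>: "\<tau> > 0" and n: "n \<ge> 1" and n0: "n0 \<ge> 1"
    and a: "1 \<le> a" "a \<le> d" and p: "2 * p \<le> m" and \<delta>: "\<delta> > 0" and len: "4 * real a * \<delta>\<^sup>2 \<le> 1"
    and target: "\<delta>\<^sup>2 * real n0 / \<tau>\<^sup>2 \<le> 1/16"
    and pairs: "(1 + (exp (4 * (\<delta>\<^sup>2 * real n / \<tau>\<^sup>2)) - 1)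
        * (exp (4 * (real a - 1) * (\<delta>\<^sup>2 * real n / \<tau>\<^sup>2)) - 1)) ^ p \<le> exp (1/4)"
  shows "ennreal (real a * \<delta>\<^sup>2 / 2 * ((real n0 + real p * real n) / (real d * \<tau>\<^sup>2)))
    \<le> intrinsic_cost C d m (\<lambda>k. if k = 0 then n0 else n) \<tau> (unit_cube m)"
  unfolding intrinsic_cost_def
proof (rule INF_greatest)
  fix est assume est: "est \<in> data_space d m \<rightarrow>\<^sub>M vec_space d"
  define N where "N = (\<lambda>k::nat. if k = 0 then n0 else n)"
  have N: "N k \<ge> 1" for k using n n0 by (simp add: N_def)
  have pos: "real n > 0" "real n0 > 0" "real d > 0" using n n0 a by auto
  interpret M: masked_sources d m p a \<delta> "\<tau> / sqrt (real n0)" "\<tau> / sqrt (real n)"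
    using a p \<delta> \<tau> pos by unfold_locales auto
  have \<sigma>: "M.\<sigma> = (\<lambda>k. \<tau> / sqrt (real (N k)))"
    by (auto simp: M.\<sigma>_def N_def)
  have \<kappa>: "M.\<kappa> = \<delta>\<^sup>2 * real n / \<tau>\<^sup>2"
    using pos by (simp add: M.\<kappa>_def power_divide)
  have budget: "exp (4 * \<delta>\<^sup>2 / (\<tau> / sqrt (real n0))\<^sup>2) * M.pair_cost ^ p \<le> 2"
  proof -
    define u where "u = (exp (4 * M.\<kappa>) - 1) * (exp (4 * (real a - 1) * M.\<kappa>) - 1)"
    have "M.\<kappa> \<ge> 0" by (simp add: M.\<kappa>_def)
    then have u: "u \<ge> 0" and E: "exp (- (real a * M.\<kappa>)) \<le> 1"
      using a by (simp_all add: u_def)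
    have "M.pair_cost = 1 + exp (- (real a * M.\<kappa>)) * u"
      by (simp add: M.pair_cost_def u_def)
    then have "0 \<le> M.pair_cost" "M.pair_cost \<le> 1 + u"
      using u mult_right_mono[OF E u] by (simp_all add: add_nonneg_nonneg)
    then have "M.pair_cost ^ p \<le> (1 + u) ^ p" by (intro power_mono)
    also have "\<dots> \<le> exp (1/4)" using pairs by (simp add: u_def \<kappa>)
    finally have "M.pair_cost ^ p \<le> exp (1/4)" .
    moreover have "exp (4 * \<delta>\<^sup>2 / (\<tau> / sqrt (real n0))\<^sup>2) \<le> exp (1/4)"
      using target pos by (simp add: power_divide mult_ac)
    ultimately have "exp (4 * \<delta>\<^sup>2 / (\<tau> / sqrt (real n0))\<^sup>2) * M.pair_cost ^ p \<le> exp (1/4) * exp (1/4)"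
      using \<open>0 \<le> M.pair_cost\<close> by (intro mult_mono) auto
    also have "\<dots> = exp (1/2)" by (simp flip: exp_add)
    also have "\<dots> \<le> 2" using exp_bound[of "1/2"] by (simp add: power2_eq_square)
    finally show ?thesis .
  qed
  define R where "R = real d * \<tau>\<^sup>2 / (real n0 + real p * real n)"
  have R: "R > 0" using pos \<tau> by (simp add: R_def add_pos_nonneg)
  let ?cost = "adaptation_cost C d m N \<tau> est (unit_cube m)"
  have "ennreal (real a * \<delta>\<^sup>2 / 2) \<le> ?cost * ennreal R"
  proof (rule M.hypercube_bound[OF budget est])
    fix B T
    define P where "P = gauss_data d m (M.\<theta> B T) M.\<sigma>"
    define h where "h = (\<lambda>k\<in>{1..m}. L2_set (\<lambda>i. M.\<theta> B T k i - M.\<theta> B T 0 i) {..<d})"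
    (* the sources aligned with the target *)
    define A where "A = {k\<in>{1..2*p}. M.role T k = 1}"
    have dist: "(L2_set (\<lambda>i. M.\<theta> B T k i - M.\<theta> B T 0 i) {..<d})\<^sup>2
        = real a * (\<delta> * (M.role T k - 1))\<^sup>2" for k
    proof -
      have "(L2_set (\<lambda>i. M.\<theta> B T k i - M.\<theta> B T 0 i) {..<d})\<^sup>2
          = (\<Sum>i<d. (M.\<theta> B T k i - M.\<theta> B T 0 i)\<^sup>2)"
        by (simp add: L2_set_def sum_nonneg)
      also have "\<dots> = (\<Sum>i<d. if i < a then (\<delta> * (M.role T k - 1))\<^sup>2 else 0)"
      proof (rule sum.cong[OF refl])
        fix i assume "i \<in> {..<d}"
        then have "M.\<theta> B T k i - M.\<theta> B T 0 i = (if i < a then \<delta> * (M.role T k - 1) * sg B i else 0)"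
          by (simp add: M.\<theta>_def M.role_def[of T 0] algebra_simps)
        then show "(M.\<theta> B T k i - M.\<theta> B T 0 i)\<^sup>2 = (if i < a then (\<delta> * (M.role T k - 1))\<^sup>2 else 0)"
          by (simp add: power_mult_distrib)
      qed
      finally show ?thesis by (simp add: M.sum_active)
    qed
    have role: "\<bar>M.role T k - 1\<bar> \<le> 2" for k by (simp add: M.role_def sg_def)
    have "h \<in> unit_cube m"
      unfolding unit_cube_def
    proof (rule PiE_I)
      fix k assume k: "k \<in> {1..m}"
      have "(M.role T k - 1)\<^sup>2 \<le> 2\<^sup>2"
        using role[of k] by (subst abs_le_square_iff[symmetric]) simp
      then have "real a * (\<delta> * (M.role T k - 1))\<^sup>2 \<le> real a * (\<delta>\<^sup>2 * 2\<^sup>2)"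
        unfolding power_mult_distrib by (intro mult_left_mono) auto
      then have "(L2_set (\<lambda>i. M.\<theta> B T k i - M.\<theta> B T 0 i) {..<d})\<^sup>2 \<le> 1\<^sup>2"
        unfolding dist using len by (simp add: mult_ac)
      then have "L2_set (\<lambda>i. M.\<theta> B T k i - M.\<theta> B T 0 i) {..<d} \<le> 1"
        by (rule power2_le_imp_le) simp
      then show "h k \<in> {0..1}" using k by (simp add: h_def L2_set_nonneg)
    qed (simp only: h_def restrict_def if_False)
    have "admissible C d m h N \<tau> (M.\<theta> B T) (gauss_data d m (M.\<theta> B T) (\<lambda>k. \<tau> / sqrt (real (N k))))"
    proof (rule gauss_data_admissible[OF C \<tau> N])
      show "M.\<theta> B T k \<in> space (vec_space d)" for k
        by (simp add: M.\<theta>_def vec_space_def space_PiM)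
      show "L2_set (\<lambda>i. M.\<theta> B T k i - M.\<theta> B T 0 i) {..<d} \<le> h k" if "k \<in> {1..m}" for k
        using that by (simp add: h_def)
    qed
    then have adm: "admissible C d m h N \<tau> (M.\<theta> B T) P" by (simp add: P_def \<sigma>)
    have "oracle_rate d m h N \<tau> \<le> real d * \<tau>\<^sup>2 / (real (N 0) + (\<Sum>k\<in>A. real (N k)))"
    proof (rule oracle_rate_le)
      show "A \<subseteq> {1..m}" using p by (auto simp: A_def)
      fix k assume k: "k \<in> A"
      then have "(L2_set (\<lambda>i. M.\<theta> B T k i - M.\<theta> B T 0 i) {..<d})\<^sup>2 = 0"
        by (simp add: dist A_def)
      then show "h k = 0" using k p by (auto simp: h_def A_def)
    qed
    also have "(\<Sum>k\<in>A. real (N k)) = real (card A) * real n"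
      by (simp add: A_def N_def)
    also have "card A = p"
    proof -
      have "A = ({1..p} \<inter> T) \<union> (\<lambda>k. k + p) ` ({1..p} - T)"
      proof (intro equalityI subsetI)
        fix k assume k: "k \<in> A"
        show "k \<in> ({1..p} \<inter> T) \<union> (\<lambda>k. k + p) ` ({1..p} - T)"
        proof (cases "k \<le> p")
          case True
          then show ?thesis using k by (auto simp: A_def M.role_def sg_def split: if_splits)
        next
          case False
          then have "k = (k - p) + p" "k - p \<in> {1..p} - T"
            using k by (auto simp: A_def M.role_def sg_def split: if_splits)
          then show ?thesis by blast
        qed
      qed (auto simp: A_def M.role_def sg_def)
      moreover have "card (({1..p} \<inter> T) \<union> (\<lambda>k. k + p) ` ({1..p} - T))
          = card ({1..p} \<inter> T) + card ({1..p} - T)"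
        by (subst card_Un_disjoint) (auto simp: card_image)
      moreover have "card ({1..p} \<inter> T) + card ({1..p} - T) = card {1..p}"
        using sum.Int_Diff[of "{1..p}" "\<lambda>_. 1 :: nat" T] by simp
      ultimately show ?thesis by simp
    qed
    also have "N 0 = n0" by (simp add: N_def)
    finally have rate: "oracle_rate d m h N \<tau> \<le> R" by (simp add: R_def)
    let ?risk = "\<integral>\<^sup>+\<omega>. ennreal ((L2_set (\<lambda>i. est \<omega> i - M.\<theta> B T 0 i) {..<d})\<^sup>2) \<partial>P"
    have "?risk \<le> worst_risk C d m h N \<tau> est"
      unfolding worst_risk_def using adm by (intro SUP_upper2[of "(M.\<theta> B T, P)"]) auto
    then have "?risk / ennreal R \<le> worst_risk C d m h N \<tau> est / ennreal R"
      by (rule divide_right_mono_ennreal)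
    also have "\<dots> \<le> worst_risk C d m h N \<tau> est / ennreal (oracle_rate d m h N \<tau>)"
      by (rule divide_ennreal_antimono[OF rate])
    also have "\<dots> \<le> ?cost"
      unfolding adaptation_cost_def by (rule SUP_upper) fact
    finally have "?risk / ennreal R * ennreal R \<le> ?cost * ennreal R"
      by (rule mult_right_mono) simp
    also have "?risk / ennreal R * ennreal R = ?risk"
      using R by (simp add: ennreal_divide_times)
    finally show "(\<integral>\<^sup>+\<omega>. ennreal ((L2_set (\<lambda>i. est \<omega> i - M.\<theta> B T 0 i) {..<d})\<^sup>2)
        \<partial>gauss_data d m (M.\<theta> B T) M.\<sigma>) \<le> ?cost * ennreal R"
      by (simp add: P_def)
  qed
  then have "ennreal (real a * \<delta>\<^sup>2 / 2) / ennreal R \<le> ?cost * ennreal R / ennreal R"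
    by (rule divide_right_mono_ennreal)
  also have "?cost * ennreal R / ennreal R = ?cost"
    using R by (intro ennreal_mult_divide_eq) auto
  also have "ennreal (real a * \<delta>\<^sup>2 / 2) / ennreal R
      = ennreal (real a * \<delta>\<^sup>2 / 2 * ((real n0 + real p * real n) / (real d * \<tau>\<^sup>2)))"
    using R by (subst divide_ennreal) (simp_all add: R_def)
  finally show "ennreal (real a * \<delta>\<^sup>2 / 2 * ((real n0 + real p * real n) / (real d * \<tau>\<^sup>2)))
      \<le> adaptation_cost C d m (\<lambda>k. if k = 0 then n0 else n) \<tau> est (unit_cube m)"
    by (simp add: N_def)
qed

section \<open>Choice of the dimension, the number of pairs and the radius\<close>

lemma exp_minus_one_le:
  fixes x :: real
  assumes "0 \<le> x" "x \<le> 1"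
  shows "exp x - 1 \<le> 2 * x"
proof -
  have "exp x \<le> 1 + x + x\<^sup>2" using assms by (rule exp_bound)
  also have "x\<^sup>2 \<le> x" using assms by (simp add: power2_eq_square mult_left_le)
  finally show ?thesis by simp
qed

text \<open>
  Both exponents are at most 1, so each difference from 1 is at most twice its exponent, and
  \<open>(1 + u) ^ p \<le> exp (p * u)\<close>.
\<close>

lemma pair_budget:
  fixes \<kappa> :: real and a p :: nat
  assumes a: "a \<ge> 1" and \<kappa>: "\<kappa> \<ge> 0" and small: "real a * \<kappa> \<le> 1/4"
    and total: "64 * real p * real a * \<kappa>\<^sup>2 \<le> 1/4"
  shows "(1 + (exp (4 * \<kappa>) - 1) * (exp (4 * (real a - 1) * \<kappa>) - 1)) ^ p \<le> exp (1/4)"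
proof -
  have \<kappa>a: "\<kappa> \<le> real a * \<kappa>" using a \<kappa> by (simp add: mult_right_mono[of 1 "real a" \<kappa>, simplified])
  have 1: "exp (4 * \<kappa>) - 1 \<le> 8 * \<kappa>"
    using exp_minus_one_le[of "4 * \<kappa>"] \<kappa> \<kappa>a small by simp
  have "4 * (real a - 1) * \<kappa> \<le> 4 * (real a * \<kappa>)" using \<kappa> by (simp add: algebra_simps)
  then have 2: "exp (4 * (real a - 1) * \<kappa>) - 1 \<le> 8 * (real a * \<kappa>)"
    using exp_minus_one_le[of "4 * (real a - 1) * \<kappa>"] \<kappa> a small by simp
  let ?u = "(exp (4 * \<kappa>) - 1) * (exp (4 * (real a - 1) * \<kappa>) - 1)"
  have u0: "0 \<le> ?u" using \<kappa> a by simp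
  have "?u \<le> (8 * \<kappa>) * (8 * (real a * \<kappa>))"
    using \<kappa> a by (intro mult_mono 1 2) auto
  then have u: "?u \<le> 64 * real a * \<kappa>\<^sup>2" by (simp add: power2_eq_square mult_ac)
  have "(1 + ?u) ^ p \<le> exp ?u ^ p"
    using u0 by (intro power_mono exp_ge_add_one_self) simp
  also have "\<dots> = exp (real p * ?u)" by (simp add: exp_of_nat_mult)
  also have "real p * ?u \<le> real p * (64 * real a * \<kappa>\<^sup>2)"
    using u by (intro mult_left_mono) auto
  then have "exp (real p * ?u) \<le> exp (1/4)" using total by simp
  finally show ?thesis .
qed

context
  fixes C \<tau> :: real and m n n0 d :: nat
  assumes C: "C \<ge> 1/2" and m: "m \<ge> 2" and n: "n \<ge> 1" and n0: "n0 \<ge> 1" and d: "d \<ge> 1"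
    and \<tau>: "\<tau> > 0" and regime: "real d * \<tau>\<^sup>2 / real n0 \<le> 1"
begin

abbreviation (input) cost :: ennreal where
  "cost \<equiv> intrinsic_cost C d m (\<lambda>k. if k = 0 then n0 else n) \<tau> (unit_cube m)"

lemma reals_pos: "real n > 0" "real n0 > 0" "real d > 0" "real m > 0"
  using m n n0 d by auto

lemma radius_bound:
  assumes "a \<le> d" and "\<delta>\<^sup>2 \<le> \<tau>\<^sup>2 / (16 * real n0)"
  shows "4 * real a * \<delta>\<^sup>2 \<le> 1" and "\<delta>\<^sup>2 * real n0 / \<tau>\<^sup>2 \<le> 1/16"
proof -
  have "real a * \<delta>\<^sup>2 \<le> real d * (\<tau>\<^sup>2 / (16 * real n0))"
    using assms by (intro mult_mono) auto
  also have "\<dots> = (real d * \<tau>\<^sup>2 / real n0) / 16" by simp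
  also have "\<dots> \<le> 1 / 16" using regime by (rule divide_right_mono) simp
  finally show "4 * real a * \<delta>\<^sup>2 \<le> 1" by linarith
  show "\<delta>\<^sup>2 * real n0 / \<tau>\<^sup>2 \<le> 1/16"
    using assms(2) reals_pos \<tau> by (simp add: field_simps)
qed

lemma third_le_half: "real m / 3 \<le> real (m div 2)"
proof -
  have "m \<le> 3 * (m div 2)" using m by presburger
  then show ?thesis by linarith
qed

text \<open>
  Without informative sources (\<open>p = 0\<close>) only the target is left, and the classical lower bound
  for its \<open>d\<close>-dimensional mean matches the rate of using the target alone.
\<close>

lemma cost_ge_one: "ennreal (1/32) \<le> cost"
proof -
  define \<delta> where "\<delta> = \<tau> / (4 * sqrt (real n0))"
  have \<delta>2: "\<delta>\<^sup>2 = \<tau>\<^sup>2 / (16 * real n0)"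
    using reals_pos by (simp add: \<delta>_def power_divide power_mult_distrib)
  have "ennreal (real d * \<delta>\<^sup>2 / 2 * ((real n0 + real 0 * real n) / (real d * \<tau>\<^sup>2))) \<le> cost"
  proof (rule intrinsic_cost_ge[OF C \<tau> n n0 d order_refl])
    show "4 * real d * \<delta>\<^sup>2 \<le> 1" "\<delta>\<^sup>2 * real n0 / \<tau>\<^sup>2 \<le> 1/16"
      using radius_bound[of d \<delta>] by (simp_all add: \<delta>2)
  qed (use \<tau> reals_pos in \<open>simp_all add: \<delta>_def\<close>)
  also have "real d * \<delta>\<^sup>2 / 2 * ((real n0 + real 0 * real n) / (real d * \<tau>\<^sup>2)) = 1/32"
    using \<tau> reals_pos by (simp add: \<delta>2)
  finally show ?thesis .
qed

text \<open>
  With one active coordinate the hidden signs mask the target for every \<open>\<kappa>\<close>, so \<open>\<delta>\<^sup>2\<close> can be as large as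
  \<open>\<tau>\<^sup>2 / n0\<close> up to a constant, while the oracle achieves \<open>d \<tau>\<^sup>2 / (m n)\<close> up to a constant.
\<close>

lemma cost_ge_one_dimensional:
  "ennreal (real m * real n / (96 * (real d * real n0))) \<le> cost"
proof -
  define \<delta> where "\<delta> = \<tau> / (4 * sqrt (real n0))"
  have \<delta>2: "\<delta>\<^sup>2 = \<tau>\<^sup>2 / (16 * real n0)"
    using reals_pos by (simp add: \<delta>_def power_divide power_mult_distrib)
  let ?p = "m div 2"
  have "real m * real n / (96 * (real d * real n0)) = (real m / 3 * real n) / (32 * real d * real n0)"
    by simp
  also have "\<dots> \<le> (real n0 + real ?p * real n) / (32 * real d * real n0)"
    using third_le_half reals_pos
    by (intro divide_right_mono add_increasing mult_right_mono) auto
  also have "\<dots> = real 1 * \<delta>\<^sup>2 / 2 * ((real n0 + real ?p * real n) / (real d * \<tau>\<^sup>2))"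
    using \<tau> reals_pos by (simp add: \<delta>2 field_simps)
  finally have "ennreal (real m * real n / (96 * (real d * real n0)))
      \<le> ennreal (real 1 * \<delta>\<^sup>2 / 2 * ((real n0 + real ?p * real n) / (real d * \<tau>\<^sup>2)))"
    by (rule ennreal_leI)
  also have "\<dots> \<le> cost"
  proof (rule intrinsic_cost_ge[OF C \<tau> n n0 _ d])
    show "4 * real 1 * \<delta>\<^sup>2 \<le> 1" "\<delta>\<^sup>2 * real n0 / \<tau>\<^sup>2 \<le> 1/16"
      using radius_bound[of 1 \<delta>] d by (simp_all add: \<delta>2)
  qed (use \<tau> reals_pos in \<open>simp_all add: \<delta>_def\<close>)
  finally show ?thesis .
qed

text \<open>
  With all coordinates active the pairs must stay uninformative, which requires \<open>m * d * \<kappa>\<^sup>2\<close> to be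
  bounded. The radius is therefore the smaller one of the radius for the target and the one with
  \<open>\<kappa>\<close> of order \<open>1 / sqrt (m * d)\<close>; the two give the two terms of the minimum. The condition \<open>d \<le> m\<close>
  keeps \<open>d * \<kappa>\<close> bounded.
\<close>

lemma cost_ge_full_dimensional:
  assumes dm: "d \<le> m"
  shows "ennreal (min (real m * real n / real n0) (sqrt (real m / real d)) / 96) \<le> cost"
proof -
  let ?p = "m div 2"
  define q where "q = sqrt (real m * real d)"
  have q: "q > 0" "q\<^sup>2 = real m * real d" using reals_pos by (simp_all add: q_def)
  (* w is the squared radius in units of the squared noise level \<tau>\<^sup>2. The constant 12 satisfies
     32 / 12^2 \<le> 1/4, as needed for the total information of the m div 2 pairs. *)
  define w where "w = min (1 / (16 * real n0)) (1 / (12 * real n * q))"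
  have w: "w > 0" "w \<le> 1 / (16 * real n0)" "w \<le> 1 / (12 * real n * q)"
    using reals_pos q by (simp_all add: w_def)
  define \<delta> where "\<delta> = \<tau> * sqrt w"
  have \<delta>2: "\<delta>\<^sup>2 = \<tau>\<^sup>2 * w" using w by (simp add: \<delta>_def power_mult_distrib)
  have \<kappa>: "\<delta>\<^sup>2 * real n / \<tau>\<^sup>2 = w * real n" using \<tau> by (simp add: \<delta>2)
  have wn: "w * real n \<le> 1 / (12 * q)"
    using mult_right_mono[OF w(3), of "real n"] reals_pos by simp
  have ratio: "real m / q = sqrt (real m / real d)"
    using reals_pos by (simp add: q_def real_sqrt_mult real_sqrt_divide field_simps)
  have "min (real m * real n / real n0) (sqrt (real m / real d)) / 96 \<le> real m * real n * w / 6"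
  proof -
    have "w = 1 / (16 * real n0) \<or> w = 1 / (12 * real n * q)"
      by (simp add: w_def min_def)
    then consider "w = 1 / (16 * real n0)" | "w = 1 / (12 * real n * q)" by blast
    then show ?thesis
    proof cases
      case 1
      have "min (real m * real n / real n0) (sqrt (real m / real d)) \<le> real m * real n / real n0"
        by simp
      then show ?thesis by (simp add: 1)
    next
      case 2
      have "min (real m * real n / real n0) (sqrt (real m / real d)) / 96 \<le> (real m / q) / 96"
        by (intro divide_right_mono) (simp_all add: ratio)
      also have "\<dots> \<le> (real m / q) / 72" using q by (intro divide_left_mono) auto
      also have "\<dots> = real m * real n * w / 6"
        using reals_pos by (simp add: 2)
      finally show ?thesis .
    qed
  qed
  also have "\<dots> = (real m / 3 * real n) * w / 2" by simp
  also have "\<dots> \<le> (real n0 + real ?p * real n) * w / 2"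
    using third_le_half reals_pos w
    by (intro divide_right_mono mult_right_mono add_increasing) auto
  also have "\<dots> = real d * \<delta>\<^sup>2 / 2 * ((real n0 + real ?p * real n) / (real d * \<tau>\<^sup>2))"
    using \<tau> reals_pos by (simp add: \<delta>2)
  finally have "ennreal (min (real m * real n / real n0) (sqrt (real m / real d)) / 96)
      \<le> ennreal (real d * \<delta>\<^sup>2 / 2 * ((real n0 + real ?p * real n) / (real d * \<tau>\<^sup>2)))"
    by (rule ennreal_leI)
  also have "\<dots> \<le> cost"
  proof (rule intrinsic_cost_ge[OF C \<tau> n n0 d order_refl])
    have "\<tau>\<^sup>2 * w \<le> \<tau>\<^sup>2 * (1 / (16 * real n0))"
      using w by (intro mult_left_mono) auto
    then have "\<delta>\<^sup>2 \<le> \<tau>\<^sup>2 / (16 * real n0)" by (simp add: \<delta>2)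
    then show "4 * real d * \<delta>\<^sup>2 \<le> 1" "\<delta>\<^sup>2 * real n0 / \<tau>\<^sup>2 \<le> 1/16"
      by (rule radius_bound[OF order_refl])+
    show "(1 + (exp (4 * (\<delta>\<^sup>2 * real n / \<tau>\<^sup>2)) - 1)
        * (exp (4 * (real d - 1) * (\<delta>\<^sup>2 * real n / \<tau>\<^sup>2)) - 1)) ^ ?p \<le> exp (1/4)"
      unfolding \<kappa>
    proof (rule pair_budget[OF d])
      show "0 \<le> w * real n" using w by simp
      have "real d * real d \<le> real m * real d" using dm by (intro mult_right_mono) auto
      then have "real d \<le> q" unfolding q_def by (intro real_le_rsqrt) (simp add: power2_eq_square)
      then have "real d * (w * real n) \<le> q * (1 / (12 * q))"
        using wn w q by (intro mult_mono) auto
      then show "real d * (w * real n) \<le> 1/4" using q by simp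
      have "(w * real n)\<^sup>2 \<le> (1 / (12 * q))\<^sup>2" using wn w by (intro power_mono) auto
      also have "\<dots> = 1 / (144 * (real m * real d))" using q by (simp add: power_divide power_mult_distrib)
      finally have sq: "(w * real n)\<^sup>2 \<le> 1 / (144 * (real m * real d))" .
      have "64 * real ?p * real d * (w * real n)\<^sup>2 \<le> (32 * real m * real d) * (1 / (144 * (real m * real d)))"
      proof (rule mult_mono[OF _ sq])
        have "64 * real ?p \<le> 32 * real m" by linarith
        then show "64 * real ?p * real d \<le> 32 * real m * real d" by (rule mult_right_mono) simp
      qed auto
      also have "\<dots> \<le> 1/4" using reals_pos by simp
      finally show "64 * real ?p * real d * (w * real n)\<^sup>2 \<le> 1/4" .
    qed
  qed (use \<tau> w in \<open>simp_all add: \<delta>_def\<close>)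
  finally show ?thesis .
qed

text \<open>
  For \<open>d > m\<close> the minimum is at most 1, so the bound by a constant covers it.
\<close>

lemma cost_ge:
  "ennreal (1/96 * max (max (min (real m * real n / real n0) (sqrt (real m / real d)))
      (real m * real n / (real d * real n0))) 1) \<le> cost"
proof -
  let ?x = "min (real m * real n / real n0) (sqrt (real m / real d))"
  let ?y = "real m * real n / (real d * real n0)"
  have one: "ennreal (1/96 * 1) \<le> cost"
    using cost_ge_one by (rule order_trans[rotated]) (simp add: ennreal_leI)
  have y: "ennreal (1/96 * ?y) \<le> cost"
    using cost_ge_one_dimensional by simp
  have x: "ennreal (1/96 * ?x) \<le> cost"
  proof (cases "d \<le> m")
    case True
    then show ?thesis using cost_ge_full_dimensional by simp
  next
    case False
    then have "sqrt (real m / real d) \<le> 1" by simp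
    then have "1/96 * ?x \<le> 1/96 * 1" by (intro mult_left_mono min.coboundedI2) auto
    then show ?thesis using one order_trans[OF ennreal_leI] by blast
  qed
  show ?thesis
  proof -
    have "max (max ?x ?y) 1 = ?x \<or> max (max ?x ?y) 1 = ?y \<or> max (max ?x ?y) 1 = 1"
      unfolding max_def by presburger
    then show ?thesis using one x y by metis
  qed
qed

end

theorem corollary10:
  "\<exists>c>0. \<forall>C\<ge>1/2. \<forall>(m :: nat \<Rightarrow> nat) (n :: nat \<Rightarrow> nat) (n0 :: nat \<Rightarrow> nat) (d :: nat \<Rightarrow> nat) (\<tau> :: nat \<Rightarrow> real).
     (\<forall>j. m j \<ge> 2 \<and> n j \<ge> 1 \<and> n0 j \<ge> 1 \<and> d j \<ge> 1 \<and> \<tau> j > 0 \<and>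
          real (d j) * (\<tau> j)\<^sup>2 / real (n0 j) \<le> 1) \<and>
     (\<lambda>j. real (n0 j) / (real (m j) * real (n j))) \<longlonglongrightarrow> 0 \<longrightarrow>
     (\<forall>\<^sub>F j in sequentially.
        intrinsic_cost C (d j) (m j) (\<lambda>k. if k = 0 then n0 j else n j) (\<tau> j) (unit_cube (m j))
          \<ge> ennreal (c * max (max (min (real (m j) * real (n j) / real (n0 j))
                                       (sqrt (real (m j) / real (d j))))
                                  (real (m j) * real (n j) / (real (d j) * real (n0 j))))
                             1)) \<and>
     ((\<forall>j. n0 j = n j) \<longrightarrow>
        (\<forall>\<^sub>F j in sequentially.
           intrinsic_cost C (d j) (m j) (\<lambda>k. if k = 0 then n0 j else n j) (\<tau> j) (unit_cube (m j))
             \<ge> ennreal (c * max (real (m j) / real (d j)) 1)))"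
proof (intro exI[of _ "1/96"] conjI allI impI always_eventually)
  show "(0::real) < 1/96" by simp
next
  fix C :: real and m n n0 d :: "nat \<Rightarrow> nat" and \<tau> :: "nat \<Rightarrow> real" and j
  assume C: "1/2 \<le> C"
    and h: "(\<forall>j. m j \<ge> 2 \<and> n j \<ge> 1 \<and> n0 j \<ge> 1 \<and> d j \<ge> 1 \<and> \<tau> j > 0 \<and>
          real (d j) * (\<tau> j)\<^sup>2 / real (n0 j) \<le> 1) \<and>
     (\<lambda>j. real (n0 j) / (real (m j) * real (n j))) \<longlonglongrightarrow> 0"
  show *: "ennreal (1/96 * max (max (min (real (m j) * real (n j) / real (n0 j))
                                       (sqrt (real (m j) / real (d j))))
                                  (real (m j) * real (n j) / (real (d j) * real (n0 j))))
                             1)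
    \<le> intrinsic_cost C (d j) (m j) (\<lambda>k. if k = 0 then n0 j else n j) (\<tau> j) (unit_cube (m j))"
    using h by (intro cost_ge C) auto
  assume eq: "\<forall>j. n0 j = n j"
  have "n j \<ge> 1" using h by auto
  then have "max (real (m j) / real (d j)) 1
      \<le> max (max (min (real (m j) * real (n j) / real (n0 j)) (sqrt (real (m j) / real (d j))))
          (real (m j) * real (n j) / (real (d j) * real (n0 j)))) 1"
    by (simp add: eq)
  then have "ennreal (1/96 * max (real (m j) / real (d j)) 1)
      \<le> ennreal (1/96 * max (max (min (real (m j) * real (n j) / real (n0 j))
          (sqrt (real (m j) / real (d j)))) (real (m j) * real (n j) / (real (d j) * real (n0 j)))) 1)"
    by (intro ennreal_leI mult_left_mono) auto
  also note *
  finally show "ennreal (1/96 * max (real (m j) / real (d j)) 1)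
    \<le> intrinsic_cost C (d j) (m j) (\<lambda>k. if k = 0 then n0 j else n j) (\<tau> j) (unit_cube (m j))" .
qed

end
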